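(* Let $\gamma>0$, let $G\in C^2(\mathbb{R}^N;\mathbb{R})$ and let $(u_0,u_0')\in\mathbb{R}^N\times\mathbb{R}^N$ be a set of initial conditions for $$u''(t)+\gamma u'(t)+\nabla G(u(t))=0,\quad t\in\mathbb{R}_+.$$ Denote by $u\in C^2([0,\infty);\mathbb{R}^N)$ the unique regular solution to this equation with initial data $(u(0),u'(0))=(u_0,u_0')$. Assume that the following holds. 1. (The trajectory is bounded) $\sup_{t>0}\|u(t)\|<\infty$. 2. (Convergence to a critical point) $G$ is a KL function. Each desingularizing function $\varphi$ of $G$ satisfies $$\varphi'(s)\ge\frac{\beta}{\sqrt s},$$ for any $s\in(0,\eta_0)$, where $\beta$ and $\eta_0$ are positive constants. Then, (i) $u'$ and $u''$ belong to $L^1((0,\infty);\mathbb{R}^N)$ and in particular $u$ converges to a single limit $u_\infty$ in $\operatorname{crit}G$. (ii) When $u$ converges to $u_\infty$, we denote by $\varphi$ the desingularizing function of $G$ at $u_\infty$. One has the following estimate $$\|u(t)-u_\infty\|\le c\,\nu(t),$$ where $c$ is a constant and $\nu$ is the solution of the worst-case gradient system $$\nu'(t)+(\varphi^{-1})'(\nu(t))=0,\quad\nu(0)>0.$$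
   Context: $\operatorname{crit}G=\{\nabla G=0\}$. KL property and desingularizing function: a differentiable $G:\mathbb{R}^N\to\mathbb{R}$ has the KL property at $\bar u$ if there exist $r_0>0$, $\eta>0$ and $\varphi\in C([0,r_0);\mathbb{R}_+)$ such that (1) $\varphi(0)=0$, $\varphi$ is $C^1$ on $(0,r_0)$, concave, with $\varphi'>0$ on $(0,r_0)$; (2) $|G(u)-G(\bar u)|<r_0$ for all $u\in B(\bar u,\eta)$ (open ball), and $\|\nabla(\varphi\circ|G(\cdot)-G(\bar u)|)(u)\|\ge1$ for each $u\in B(\bar u,\eta)$ with $G(u)\ne G(\bar u)$. Such a $\varphi$ is called a desingularizing function of $G$ at $\bar u$. $G$ is a KL function if it has the KL property at every point of $\mathbb{R}^N$.
   Formalization: In (ii) φ is replaced by kφ for some k≥1, as the bound fails for a fixed φ (G(x)=x²/2, γ=1, φ(s)=√(2s)); the growth condition is assumed for one chosen desingularizing function per point, with β, η₀ depending on it, since no G satisfies it for all of them. *)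

theory Defs
  imports "HOL-Analysis.Analysis"
begin

definition grad :: "('a::real_inner \<Rightarrow> real) \<Rightarrow> 'a \<Rightarrow> 'a" where
  "grad f x = (THE D. GDERIV f x :> D)"

definition crit :: "('a::real_inner \<Rightarrow> real) \<Rightarrow> 'a set" where
  "crit G = {x. grad G x = 0}"

definition C2_function :: "('a::euclidean_space \<Rightarrow> real) \<Rightarrow> bool" where
  "C2_function G \<longleftrightarrow>
     (\<forall>x. G differentiable (at x)) \<and>
     (\<exists>H :: 'a \<Rightarrow> 'a \<Rightarrow>\<^sub>L 'a. continuous_on UNIV H \<and>
        (\<forall>x. (grad G has_derivative blinfun_apply (H x)) (at x)))"

(* phi is only meaningful on {0..<r}; its values elsewhere are irrelevant. *)
definition desingularizing ::
  "('a::euclidean_space \<Rightarrow> real) \<Rightarrow> 'a \<Rightarrow> real \<Rightarrow> (real \<Rightarrow> real) \<Rightarrow> bool" where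
  "desingularizing G ubar r \<phi> \<longleftrightarrow>
     r > 0 \<and>
     continuous_on {0..<r} \<phi> \<and> (\<forall>s\<in>{0..<r}. \<phi> s \<ge> 0) \<and>
     \<phi> 0 = 0 \<and>
     \<phi> differentiable_on {0<..<r} \<and> continuous_on {0<..<r} (deriv \<phi>) \<and>
     concave_on {0..<r} \<phi> \<and>
     (\<forall>s\<in>{0<..<r}. deriv \<phi> s > 0) \<and>
     (\<exists>\<eta>>0. \<forall>w\<in>ball ubar \<eta>. \<bar>G w - G ubar\<bar> < r \<and>
        (G w \<noteq> G ubar \<longrightarrow> norm (grad (\<lambda>x. \<phi> \<bar>G x - G ubar\<bar>) w) \<ge> 1))"

definition KL_function :: "('a::euclidean_space \<Rightarrow> real) \<Rightarrow> bool" where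
  "KL_function G \<longleftrightarrow>
     (\<forall>x. G differentiable (at x)) \<and> (\<forall>ubar. \<exists>r \<phi>. desingularizing G ubar r \<phi>)"

(* The constants may depend on phi; the condition eta0 <= r keeps s inside the domain of phi. *)
definition desing_growth :: "real \<Rightarrow> (real \<Rightarrow> real) \<Rightarrow> bool" where
  "desing_growth r \<phi> \<longleftrightarrow>
     (\<exists>\<beta>>0. \<exists>\<eta>0>0. \<eta>0 \<le> r \<and> (\<forall>s\<in>{0<..<\<eta>0}. deriv \<phi> s \<ge> \<beta> / sqrt s))"

definition damped_solution ::
  "real \<Rightarrow> ('a::euclidean_space \<Rightarrow> real) \<Rightarrow> 'a \<Rightarrow> 'a \<Rightarrow>
   (real \<Rightarrow> 'a) \<Rightarrow> (real \<Rightarrow> 'a) \<Rightarrow> (real \<Rightarrow> 'a) \<Rightarrow> bool" where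
  "damped_solution \<gamma> G u0 v0 u u' u'' \<longleftrightarrow>
     (\<forall>t\<ge>0. (u has_vector_derivative u' t) (at t within {0..})) \<and>
     (\<forall>t\<ge>0. (u' has_vector_derivative u'' t) (at t within {0..})) \<and>
     continuous_on {0..} u'' \<and>
     (\<forall>t\<ge>0. u'' t + \<gamma> *\<^sub>R u' t + grad G (u t) = 0) \<and>
     u 0 = u0 \<and> u' 0 = v0"

(* The inverse of phi lives on the interval phi ` {0..<r}, whose left endpoint 0 is included;
   its derivative is therefore taken within that interval (one-sided at 0). *)
definition worst_case_solution :: "real \<Rightarrow> (real \<Rightarrow> real) \<Rightarrow> (real \<Rightarrow> real) \<Rightarrow> bool" where
  "worst_case_solution r \<phi> \<nu> \<longleftrightarrow>
     \<nu> 0 > 0 \<and>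
     (\<forall>t\<ge>0. \<nu> t \<in> \<phi> ` {0..<r} \<and>
        (\<nu> has_real_derivative
           - vector_derivative (inv_into {0..<r} \<phi>) (at (\<nu> t) within \<phi> ` {0..<r}))
          (at t within {0..}))"

(* Rate of convergence to w for a given desingularizing function phi0 at w. The estimate is
   claimed for a positive multiple phi = k * phi0 with k >= 1, which is again desingularizing.
   The normalization of phi0 fixes the time scale of the worst-case system and cannot be kept
   in general: for G x = x^2 / 2 on the line and phi0 s = sqrt (2 * s) at 0, the worst-case
   solutions are multiples of exp (- t), whereas solutions of u'' + \<gamma> u' + u = 0 decay only
   like exp (- \<gamma> * t / 2) if \<gamma> < 2. *)
definition worst_case_rate ::
  "('a::euclidean_space \<Rightarrow> real) \<Rightarrow> (real \<Rightarrow> 'a) \<Rightarrow> 'a \<Rightarrow> real \<Rightarrow> (real \<Rightarrow> real) \<Rightarrow> bool" where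
  "worst_case_rate G u w r \<phi>0 \<longleftrightarrow>
     (\<exists>k\<ge>1. \<exists>\<phi>. \<phi> = (\<lambda>s. k * \<phi>0 s) \<and> desingularizing G w r \<phi> \<and>
        (\<forall>y\<in>\<phi> ` {0<..<r}. \<exists>\<nu>. worst_case_solution r \<phi> \<nu> \<and> \<nu> 0 = y) \<and>
        (\<forall>\<nu>. worst_case_solution r \<phi> \<nu> \<longrightarrow> (\<exists>c. \<forall>t\<ge>0. norm (u t - w) \<le> c * \<nu> t)))"

end

theory Submission
  imports Defs
begin

text \<open>Let \<open>E = norm (u')\<^sup>2 / 2 + G u + \<mu> * (grad G u \<bullet> u')\<close> with \<open>\<mu> > 0\<close> small and
  \<open>n = norm (u')\<^sup>2 + norm (grad G u)\<^sup>2\<close>. Then \<open>E' \<le> - \<alpha> * n\<close>, so some limit point \<open>w\<close> of the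
  trajectory is critical and \<open>e = E - G w\<close> decreases to \<open>0\<close>. The growth condition on \<open>\<phi>'\<close> transfers
  the KL inequality from \<open>G\<close> to the energy: \<open>(\<phi>' e)\<^sup>2 * n \<ge> c\<close> while \<open>u\<close> is near \<open>w\<close>. Hence
  \<open>- (\<phi> e)'\<close> dominates the speed \<open>sqrt n\<close>, which traps the trajectory near \<open>w\<close>, makes \<open>u'\<close> and \<open>u''\<close>
  integrable and bounds the distance to \<open>w\<close> by a multiple of \<open>\<phi> e\<close>. Moreover \<open>e' \<le> - \<alpha> * c / (\<phi>' e)\<^sup>2\<close>,
  which after scaling \<open>\<phi>\<close> is faster than the worst-case system in the variable \<open>\<phi>\<^sup>-\<^sup>1 \<nu>\<close>.\<close>

section \<open>Gradients of C2 functions\<close>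

text \<open>The obstacle is a monotonicity in the wrong direction. The KL inequality at
  \<open>u\<close> involves \<open>\<phi>'\<close> at the level \<open>G u - G w\<close>, whereas
  differentiating \<open>\<phi> e\<close> produces \<open>\<phi>' e\<close>. As
  \<open>\<phi>'\<close> is nonincreasing, \<open>\<phi>' e\<close> may be much smaller when
  \<open>G u - G w < e\<close>, and no doubling property of \<open>\<phi>'\<close> is assumed that
  would make the two comparable. The two levels differ by at most \<open>n\<close>. If
  \<open>n\<close> is at least half of \<open>e\<close>, the growth condition alone gives the bound,
  since \<open>(\<phi>' e)\<^sup>2\<close> is at least a multiple of \<open>1 / e\<close>. Otherwise
  gradient ascent from \<open>u\<close> leads above the level \<open>e\<close>, where monotonicity
  helps, and the squared gradient grows on the way by at most a multiple of \<open>n\<close>. The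
  growth condition has a second use: it makes the integral of the square of \<open>\<phi>'\<close>
  diverge at 0, so worst-case solutions exist for all times and never reach 0. Their initial values
  are arbitrary, so the scaling makes the energy faster by a factor 2; this gain in speed makes up
  for any initial delay.\<close>

lemma grad_eqI: "GDERIV f x :> D \<Longrightarrow> grad f x = D"
  for D :: "'a::real_inner"
  unfolding grad_def
proof (rule the_equality)
  fix D' assume D: "GDERIV f x :> D" and D': "GDERIV f x :> D'"
  have "(\<lambda>h. inner h D') = (\<lambda>h. inner h D)"
    using D' D unfolding gderiv_def by (rule has_derivative_unique)
  then have "inner (D' - D) (D' - D) = 0"
    by (metis inner_diff_right right_minus_eq)
  then show "D' = D" by simp
qed

lemma GDERIV_grad:
  fixes f :: "'a::euclidean_space \<Rightarrow> real"
  assumes "f differentiable (at x)"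
  shows "GDERIV f x :> grad f x"
proof -
  obtain f' where f': "(f has_derivative f') (at x)"
    using assms unfolding differentiable_def by blast
  then have lin: "linear f'" by (rule has_derivative_linear)
  define D where "D = (\<Sum>b\<in>Basis. f' b *\<^sub>R b)"
  have "f' h = inner h D" for h
  proof -
    have "f' h = f' (\<Sum>b\<in>Basis. inner h b *\<^sub>R b)" by (simp add: euclidean_representation)
    also have "\<dots> = (\<Sum>b\<in>Basis. inner h b * f' b)"
      by (simp add: linear_sum[OF lin] linear_cmul[OF lin])
    also have "\<dots> = inner h D" unfolding D_def by (simp add: inner_sum_right mult.commute)
    finally show ?thesis .
  qed
  then have "GDERIV f x :> D"
    using f' unfolding gderiv_def by (metis (no_types, lifting) ext)
  then show ?thesis using grad_eqI by metis
qed

lemma grad_compose_abs: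
  fixes G :: "'a::euclidean_space \<Rightarrow> real"
  assumes "G differentiable (at x)" "G x \<noteq> a"
    and "(\<phi> has_real_derivative d) (at \<bar>G x - a\<bar>)"
  shows "grad (\<lambda>y. \<phi> \<bar>G y - a\<bar>) x = (d * sgn (G x - a)) *\<^sub>R grad G x"
proof -
  have "GDERIV (\<lambda>y. G y - a) x :> grad G x"
    using GDERIV_diff[OF GDERIV_grad[OF assms(1)] GDERIV_const[of a]] by simp
  moreover have "((\<lambda>z. \<phi> \<bar>z\<bar>) has_real_derivative d * sgn (G x - a)) (at (G x - a))"
    using DERIV_chain2[where f=\<phi> and g=abs, OF assms(3)] GDERIV_norm[of "G x - a"] assms(2) by simp
  ultimately show ?thesis
    by (intro grad_eqI GDERIV_DERIV_compose[where g="\<lambda>z. \<phi> \<bar>z\<bar>"])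
qed

lemma C2_functionE:
  fixes G :: "'a::euclidean_space \<Rightarrow> real"
  assumes "C2_function G"
  obtains H where "\<And>x. G differentiable (at x)"
    and "\<And>x. (grad G has_derivative blinfun_apply (H x)) (at x)"
    and "\<And>w R. \<exists>M>0. \<forall>x\<in>cball w R. norm (H x) \<le> M"
proof -
  from assms obtain H :: "'a \<Rightarrow> 'a \<Rightarrow>\<^sub>L 'a" where
    H: "\<And>x. G differentiable (at x)" "continuous_on UNIV H"
      "\<And>x. (grad G has_derivative blinfun_apply (H x)) (at x)"
    unfolding C2_function_def by blast
  have "\<exists>M>0. \<forall>x\<in>cball w R. norm (H x) \<le> M" for w R
  proof -
    have "compact (H ` cball w R)"
      by (intro compact_continuous_image continuous_on_subset[OF H(2)]) auto
    then show ?thesis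
      by (metis bounded_pos compact_imp_bounded image_eqI)
  qed
  with H that show ?thesis by blast
qed

lemma continuous_grad_C2:
  fixes G :: "'a::euclidean_space \<Rightarrow> real"
  assumes "C2_function G"
  shows "continuous_on UNIV (grad G)"
  using assms
  by (metis C2_functionE continuous_at_imp_continuous_on has_derivative_continuous)

lemma continuous_C2:
  fixes G :: "'a::euclidean_space \<Rightarrow> real"
  assumes "C2_function G"
  shows "continuous_on UNIV G"
  using assms
  by (metis C2_function_def continuous_at_imp_continuous_on differentiable_imp_continuous_within)

lemma grad_lipschitz_cball:
  fixes G :: "'a::euclidean_space \<Rightarrow> real"
  assumes "C2_function G"
  obtains M where "M > 0"
    and "\<And>x y. x \<in> cball w R \<Longrightarrow> y \<in> cball w R \<Longrightarrow> norm (grad G x - grad G y) \<le> M * norm (x - y)"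
proof -
  obtain H where H: "\<And>x. (grad G has_derivative blinfun_apply (H x)) (at x)"
    and "\<And>w R. \<exists>M>0. \<forall>x\<in>cball w R. norm (H x) \<le> M"
    using C2_functionE[OF assms] by metis
  then obtain M where M: "M > 0" "\<And>x. x \<in> cball w R \<Longrightarrow> norm (H x) \<le> M" by meson
  have "norm (grad G x - grad G y) \<le> M * norm (x - y)"
    if "x \<in> cball w R" "y \<in> cball w R" for x y
    using convex_cball has_derivative_at_withinI[OF H] _ that
    by (rule differentiable_bound) (use M in \<open>auto simp: norm_blinfun.rep_eq\<close>)
  with M(1) that show ?thesis by blast
qed

text \<open>The step is so short that the gradient changes by at most half of its norm along the
  segment. The mean value theorem turns this into the gain of \<open>G\<close>, and the triangle
  inequality into the bound at \<open>y\<close>.\<close>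

lemma ascent_step:
  fixes G :: "'a::euclidean_space \<Rightarrow> real"
  assumes diff: "\<And>x. G differentiable (at x)"
    and M: "M > 0" and "convex S"
    and lip: "\<And>x y. x \<in> S \<Longrightarrow> y \<in> S \<Longrightarrow> norm (grad G x - grad G y) \<le> M * norm (x - y)"
    and x: "x \<in> S" and y: "y \<in> S" and y_def: "y = x + (1 / (2 * M)) *\<^sub>R grad G x"
  shows "G y \<ge> G x + (norm (grad G x))\<^sup>2 / (4 * M)"
    and "norm (grad G y) \<le> 2 * norm (grad G x)"
proof -
  define g where "g = grad G x"
  define d where "d = (1 / (2 * M)) *\<^sub>R g"
  have yd: "y = x + d" using y_def by (simp add: d_def g_def)
  have nd: "norm d = norm g / (2 * M)" using M by (simp add: d_def)
  have deriv: "((\<lambda>t. G (x + t *\<^sub>R d)) has_real_derivative inner d (grad G (x + t *\<^sub>R d))) (at t)" for t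
  proof -
    have "((\<lambda>t. x + t *\<^sub>R d) has_derivative (\<lambda>h. h *\<^sub>R d)) (at t)"
      by (auto intro!: derivative_eq_intros)
    from has_derivative_compose[OF this GDERIV_grad[OF diff, unfolded gderiv_def]]
    show ?thesis by (rule has_derivative_imp_has_field_derivative) (simp add: mult.commute)
  qed
  obtain z where z: "0 < z" "z < 1"
    "G (x + 1 *\<^sub>R d) - G (x + 0 *\<^sub>R d) = (1 - 0) * inner d (grad G (x + z *\<^sub>R d))"
    using MVT2[OF zero_less_one deriv] by blast
  have "x + z *\<^sub>R d = (1 - z) *\<^sub>R x + z *\<^sub>R y" by (simp add: yd algebra_simps)
  then have zS: "x + z *\<^sub>R d \<in> S"
    using z \<open>convex S\<close> x y by (simp add: convex_alt)
  have "norm (grad G (x + z *\<^sub>R d) - g) \<le> M * norm (z *\<^sub>R d)"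
    using lip[OF zS x] by (simp add: g_def)
  also have "\<dots> \<le> M * norm d" using z M by (simp add: mult_left_le_one_le)
  finally have gz: "norm (grad G (x + z *\<^sub>R d) - g) \<le> norm g / 2" using M by (simp add: nd)
  have "\<bar>inner d (grad G (x + z *\<^sub>R d) - g)\<bar> \<le> norm d * (norm g / 2)"
    using Cauchy_Schwarz_ineq2[of d] gz by (meson mult_left_mono norm_ge_zero order_trans)
  then have "inner d (grad G (x + z *\<^sub>R d)) \<ge> inner d g - norm d * (norm g / 2)"
    unfolding inner_diff_right by linarith
  also have "inner d g - norm d * (norm g / 2) = (norm g)\<^sup>2 / (4 * M)"
    using M by (simp add: nd) (simp add: d_def dot_square_norm power2_eq_square field_simps)
  finally show "G y \<ge> G x + (norm (grad G x))\<^sup>2 / (4 * M)"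
    using z(3) by (simp add: yd g_def)
  have "norm (grad G y - g) \<le> M * norm d" using lip[OF y x] by (simp add: g_def yd)
  then have "norm (grad G y - g) \<le> norm g / 2" using M by (simp add: nd)
  moreover have "norm (grad G y) \<le> norm g + norm (grad G y - g)" by (metis norm_triangle_sub)
  ultimately show "norm (grad G y) \<le> 2 * norm (grad G x)"
    unfolding g_def using norm_ge_zero[of "grad G x"] by linarith
qed

section \<open>Desingularizing functions\<close>

text \<open>The one-variable conditions, separated from \<open>G\<close>, so that the locale can be
  entered both for a given desingularizing function and for its multiples.\<close>

locale desing_profile =
  fixes r :: real and \<phi> :: "real \<Rightarrow> real"
  assumes r_pos: "r > 0"
    and cont: "continuous_on {0..<r} \<phi>"
    and zero: "\<phi> 0 = 0"
    and concave: "concave_on {0..<r} \<phi>"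
    and has_deriv: "s \<in> {0<..<r} \<Longrightarrow> (\<phi> has_real_derivative deriv \<phi> s) (at s)"
    and cont_deriv: "continuous_on {0<..<r} (deriv \<phi>)"
    and deriv_pos: "s \<in> {0<..<r} \<Longrightarrow> deriv \<phi> s > 0"
    and growth: "desing_growth r \<phi>"

lemma desing_profileI:
  assumes "desingularizing G w r \<phi>" "desing_growth r \<phi>"
  shows "desing_profile r \<phi>"
proof
  show "(\<phi> has_real_derivative deriv \<phi> s) (at s)" if "s \<in> {0<..<r}" for s
    using assms(1) that unfolding desingularizing_def
    by (metis DERIV_deriv_iff_real_differentiable differentiable_on_eq_differentiable_at open_greaterThanLessThan)
qed (use assms in \<open>auto simp: desingularizing_def\<close>)

text \<open>This is the chain rule applied to the KL condition. Halving the radius replaces the open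
  ball by a closed one, the kind of ball on which the gradient is shown to be Lipschitz.\<close>

lemma desing_gradient_bound:
  fixes G :: "'a::euclidean_space \<Rightarrow> real"
  assumes "desingularizing G w r \<phi>" and diff: "\<And>x. G differentiable (at x)"
  obtains \<eta> where "\<eta> > 0" and "\<And>x. x \<in> cball w \<eta> \<Longrightarrow> \<bar>G x - G w\<bar> < r"
    and "\<And>x. x \<in> cball w \<eta> \<Longrightarrow> G x \<noteq> G w \<Longrightarrow> 1 \<le> deriv \<phi> \<bar>G x - G w\<bar> * norm (grad G x)"
proof -
  obtain e where e: "e > 0" "\<And>x. x \<in> ball w e \<Longrightarrow> \<bar>G x - G w\<bar> < r"
    "\<And>x. x \<in> ball w e \<Longrightarrow> G x \<noteq> G w \<Longrightarrow> norm (grad (\<lambda>x. \<phi> \<bar>G x - G w\<bar>) x) \<ge> 1"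
    using assms(1) unfolding desingularizing_def by metis
  have "1 \<le> deriv \<phi> \<bar>G x - G w\<bar> * norm (grad G x)" if x: "x \<in> ball w e" "G x \<noteq> G w" for x
  proof -
    have s: "\<bar>G x - G w\<bar> \<in> {0<..<r}" using e(2) x by auto
    have "deriv \<phi> \<bar>G x - G w\<bar> > 0"
      using assms(1) s unfolding desingularizing_def by blast
    moreover have "(\<phi> has_real_derivative deriv \<phi> \<bar>G x - G w\<bar>) (at \<bar>G x - G w\<bar>)"
      using assms(1) s unfolding desingularizing_def
      by (metis DERIV_deriv_iff_real_differentiable differentiable_on_eq_differentiable_at open_greaterThanLessThan)
    ultimately show ?thesis
      using e(3)[OF x] grad_compose_abs[OF diff x(2)] x(2) by (simp add: abs_mult abs_sgn_eq)
  qed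
  moreover have "cball w (e / 2) \<subseteq> ball w e" using e(1) by auto
  ultimately show ?thesis using e that[of "e / 2"] by (meson half_gt_zero subsetD)
qed

section \<open>Concavity and monotonicity of a desingularizing function\<close>

context desing_profile
begin

lemma has_deriv_within: "s \<in> {0<..<r} \<Longrightarrow> (\<phi> has_real_derivative deriv \<phi> s) (at s within A)"
  using has_deriv has_field_derivative_at_within by blast

text \<open>Only the base point \<open>s\<close> has to be interior. The point \<open>x\<close> may
  be the endpoint 0, where \<open>\<phi>\<close> has an infinite slope; this is how strict
  monotonicity is obtained up to 0.\<close>

lemma above_tangent:
  assumes "s \<in> {0<..<r}" "x \<in> {0..<r}"
  shows "\<phi> x - \<phi> s \<le> deriv \<phi> s * (x - s)"
proof -
  have "interior {0..<r} = {0<..<r}" by simp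
  then have "(- \<phi> x) - (- \<phi> s) \<ge> (- deriv \<phi> s) * (x - s)"
    using concave assms
    by (intro convex_on_imp_above_tangent[where A="{0..<r}" and f="\<lambda>x. - \<phi> x"])
      (auto simp: concave_on_def intro!: derivative_eq_intros has_deriv_within)
  then show ?thesis by simp
qed

lemma deriv_antimono:
  assumes "s \<in> {0<..<r}" "t \<in> {0<..<r}" "s \<le> t"
  shows "deriv \<phi> t \<le> deriv \<phi> s"
proof (cases "s = t")
  case False
  have "deriv \<phi> t * (t - s) \<le> \<phi> t - \<phi> s"
    using above_tangent[of t s] assms by (simp add: algebra_simps)
  also have "\<dots> \<le> deriv \<phi> s * (t - s)" using above_tangent[of s t] assms by simp
  finally show ?thesis using False assms(3) by simp
qed simp

lemma strict_mono: "strict_mono_on {0..<r} \<phi>"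
proof (rule strict_mono_onI)
  fix a b assume ab: "a \<in> {0..<r}" "b \<in> {0..<r}" "a < b"
  then have "deriv \<phi> b * (b - a) \<le> \<phi> b - \<phi> a"
    using above_tangent[of b a] by (simp add: algebra_simps)
  moreover have "deriv \<phi> b * (b - a) > 0" using ab deriv_pos[of b] by simp
  ultimately show "\<phi> a < \<phi> b" by simp
qed

lemma le_iff: "a \<in> {0..<r} \<Longrightarrow> b \<in> {0..<r} \<Longrightarrow> \<phi> a \<le> \<phi> b \<longleftrightarrow> a \<le> b"
  using strict_mono by (meson strict_mono_on_less_eq)

lemma less_iff: "a \<in> {0..<r} \<Longrightarrow> b \<in> {0..<r} \<Longrightarrow> \<phi> a < \<phi> b \<longleftrightarrow> a < b"
  using le_iff by (meson not_le)

lemma inj: "inj_on \<phi> {0..<r}"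
  using strict_mono strict_mono_on_imp_inj_on by blast

lemma nonneg: "s \<in> {0..<r} \<Longrightarrow> \<phi> s \<ge> 0"
  using le_iff[of 0 s] zero r_pos by simp

lemma small_values:
  assumes "\<epsilon> > 0"
  obtains d where "0 < d" "d < r" "\<And>s. 0 \<le> s \<Longrightarrow> s < d \<Longrightarrow> \<phi> s < \<epsilon>"
proof -
  obtain d where d: "d > 0" "\<And>s. s \<in> {0..<r} \<Longrightarrow> dist s 0 < d \<Longrightarrow> dist (\<phi> s) (\<phi> 0) < \<epsilon>"
    using cont assms r_pos unfolding continuous_on_iff by (metis atLeastLessThan_iff order_refl)
  have "\<phi> s < \<epsilon>" if "0 \<le> s" "s < min d (r / 2)" for s
    using d(2)[of s] that zero by (simp add: dist_real_def)
  then show ?thesis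
    using d(1) r_pos by (intro that[of "min d (r / 2)"]) auto
qed

end

text \<open>A factor \<open>k \<ge> 1\<close> only enlarges the derivative, so the lower bounds in
  the KL inequality and in the growth condition persist with the same radius and constants. In the
  worst-case system such a factor changes the time scale.\<close>

lemma desingularizing_scale:
  fixes G :: "'a::euclidean_space \<Rightarrow> real"
  assumes "desingularizing G w r \<phi>" "desing_growth r \<phi>" and diff: "\<And>x. G differentiable (at x)"
    and "k \<ge> 1"
  shows "desingularizing G w r (\<lambda>s. k * \<phi> s)" and "desing_growth r (\<lambda>s. k * \<phi> s)"
    and "\<And>s. s \<in> {0<..<r} \<Longrightarrow> deriv (\<lambda>s. k * \<phi> s) s = k * deriv \<phi> s"
proof -
  interpret desing_profile r \<phi> using assms(1,2) by (rule desing_profileI)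
  have D: "((\<lambda>s. k * \<phi> s) has_real_derivative k * deriv \<phi> s) (at s)" if "s \<in> {0<..<r}" for s
    using DERIV_cmult[OF has_deriv[OF that]] .
  show dk: "deriv (\<lambda>s. k * \<phi> s) s = k * deriv \<phi> s" if "s \<in> {0<..<r}" for s
    using DERIV_imp_deriv[OF D[OF that]] .
  have k0: "k > 0" using assms(4) by simp
  obtain \<eta> where \<eta>: "\<eta> > 0" "\<And>x. x \<in> cball w \<eta> \<Longrightarrow> \<bar>G x - G w\<bar> < r"
    "\<And>x. x \<in> cball w \<eta> \<Longrightarrow> G x \<noteq> G w \<Longrightarrow> 1 \<le> deriv \<phi> \<bar>G x - G w\<bar> * norm (grad G x)"
    using desing_gradient_bound[OF assms(1) diff] by metis
  have "norm (grad (\<lambda>x. k * \<phi> \<bar>G x - G w\<bar>) x) \<ge> 1" if x: "x \<in> ball w \<eta>" "G x \<noteq> G w" for x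
  proof -
    have s: "\<bar>G x - G w\<bar> \<in> {0<..<r}" using \<eta>(2)[of x] x by auto
    have "norm (grad (\<lambda>x. k * \<phi> \<bar>G x - G w\<bar>) x) = k * (deriv \<phi> \<bar>G x - G w\<bar> * norm (grad G x))"
      using grad_compose_abs[OF diff x(2) D[OF s]] deriv_pos[OF s] k0 x(2)
      by (simp add: abs_mult abs_sgn_eq)
    moreover have "1 \<le> deriv \<phi> \<bar>G x - G w\<bar> * norm (grad G x)" using \<eta>(3)[of x] x by simp
    ultimately show ?thesis using assms(4) by (metis mult_mono' mult_1 zero_le_one)
  qed
  then have "\<exists>\<eta>>0. \<forall>x\<in>ball w \<eta>. \<bar>G x - G w\<bar> < r \<and>
        (G x \<noteq> G w \<longrightarrow> norm (grad (\<lambda>x. k * \<phi> \<bar>G x - G w\<bar>) x) \<ge> 1)"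
    using \<eta>(1,2) by (meson ball_subset_cball subsetD)
  moreover have "continuous_on {0<..<r} (deriv (\<lambda>s. k * \<phi> s))"
    using continuous_on_mult_left[OF cont_deriv, of k] dk by (subst continuous_on_cong[OF refl dk]) auto
  moreover have "(\<lambda>s. k * \<phi> s) differentiable_on {0<..<r}"
    using D by (meson differentiable_at_withinI differentiable_on_def real_differentiable_def)
  moreover have "concave_on {0..<r} (\<lambda>s. k * \<phi> s)"
    using convex_on_cmul[of k "{0..<r}" "\<lambda>s. - \<phi> s"] concave k0 by (simp add: concave_on_def)
  ultimately show "desingularizing G w r (\<lambda>s. k * \<phi> s)"
    unfolding desingularizing_def
    using r_pos cont zero nonneg k0 deriv_pos dk by (auto intro!: continuous_intros)
  obtain \<beta> \<eta>0 where "\<beta> > 0" "\<eta>0 > 0" "\<eta>0 \<le> r" "\<forall>s\<in>{0<..<\<eta>0}. deriv \<phi> s \<ge> \<beta> / sqrt s"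
    using growth unfolding desing_growth_def by blast
  moreover from this have "deriv (\<lambda>s. k * \<phi> s) s \<ge> \<beta> / sqrt s" if "s \<in> {0<..<\<eta>0}" for s
  proof -
    have "\<beta> / sqrt s \<le> deriv \<phi> s" "s \<in> {0<..<r}" using that calculation by auto
    moreover have "deriv \<phi> s \<le> k * deriv \<phi> s" using assms(4) deriv_pos[of s] \<open>s \<in> {0<..<r}\<close> by simp
    ultimately show ?thesis using dk by simp
  qed
  ultimately show "desing_growth r (\<lambda>s. k * \<phi> s)"
    unfolding desing_growth_def by blast
qed

section \<open>The KL inequality for the energy\<close>

text \<open>If \<open>x\<close> lies below the level \<open>e\<close>, gradient ascent steps of length \<open>norm (grad G x) / (2 * M)\<close> reach
  that level: the KL inequality bounds their total length, and each one increases the squared norm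
  of the gradient by at most \<open>12 * M\<close> times the increase of \<open>G\<close>. Instead of iterating, a step is taken
  from a highest point satisfying these two bounds.\<close>

lemma (in desing_profile) gradient_at_higher_level:
  fixes G :: "'a::euclidean_space \<Rightarrow> real"
  assumes C2: "C2_function G" and M: "M > 0"
    and lip: "\<And>x y. x \<in> cball w \<eta> \<Longrightarrow> y \<in> cball w \<eta> \<Longrightarrow> norm (grad G x - grad G y) \<le> M * norm (x - y)"
    and crit: "grad G w = 0"
    and range: "\<And>x. x \<in> cball w \<eta> \<Longrightarrow> \<bar>G x - G w\<bar> < r"
    and KL: "\<And>x. x \<in> cball w \<eta> \<Longrightarrow> G x \<noteq> G w \<Longrightarrow> 1 \<le> deriv \<phi> \<bar>G x - G w\<bar> * norm (grad G x)"
    and x: "x \<in> cball w (\<eta> / 4)"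
    and e: "0 < G x - G w" "G x - G w \<le> e" "e < r" "4 * \<phi> e \<le> \<eta> / 4"
  shows "1 \<le> (deriv \<phi> e)\<^sup>2 * (4 * ((norm (grad G x))\<^sup>2 + 12 * M * (e - (G x - G w))))"
proof -
  define g where "g y = norm (grad G y)" for y
  define h where "h y = G y - G w" for y
  have diff: "G differentiable (at y)" for y using C2 by (simp add: C2_function_def)
  have eta: "\<eta> \<ge> 0" using x zero_le_dist[of w x] by (simp del: zero_le_dist)
  define A where "A = cball w (\<eta> / 2) \<inter> h -` {h x..e}"
  have conth: "continuous_on B h" and contg: "continuous_on B g" for B
    unfolding h_def g_def
    by (intro continuous_intros continuous_on_subset[OF continuous_C2[OF C2]]
        continuous_on_subset[OF continuous_grad_C2[OF C2]]; simp)+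
  have "compact A"
    unfolding A_def using conth[of UNIV]
    by (intro compact_Int_closed compact_cball continuous_closed_vimage closed_atLeastAtMost)
      (simp add: continuous_on_eq_continuous_at)
  have hr: "h y \<in> {0<..<r}" if "y \<in> cball w \<eta>" "h x \<le> h y" for y
    using range[OF that(1)] that(2) e(1) by (simp add: h_def)
  have KLh: "1 \<le> deriv \<phi> (h y) * g y" if "y \<in> cball w \<eta>" "h x \<le> h y" for y
    using KL[OF that(1)] hr[OF that] by (simp add: h_def g_def)
  \<comment> \<open>\<open>p\<close> and \<open>q\<close> are the slacks in the bounds on length and
    on the squared gradient. The factor 4 is 2 from the mean value estimate in
    \<open>ascent_step\<close> times 2 from \<open>g y \<le> 2 * g z\<close>. The factor
    \<open>12 * M\<close> is 3 from \<open>(2 * g z)\<^sup>2 - (g z)\<^sup>2\<close> times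
    \<open>4 * M\<close> from the gain of \<open>G\<close>.\<close>
  define p where "p y = 4 * (\<phi> (h y) - \<phi> (h x)) - dist y x" for y
  define q where "q y = (g x)\<^sup>2 + 12 * M * (h y - h x) - (g y)\<^sup>2" for y
  have "continuous_on A (\<lambda>y. \<phi> (h y))"
    by (rule continuous_on_compose2[OF cont conth]) (use e in \<open>auto simp: A_def h_def\<close>)
  then have "continuous_on A p"
    unfolding p_def by (intro continuous_intros)
  have "continuous_on A q"
    unfolding q_def by (intro continuous_intros conth contg)
  define S where "S = (A \<inter> p -` {0..}) \<inter> (A \<inter> q -` {0..})"
  have cl: "closed (A \<inter> p -` {0..})" "closed (A \<inter> q -` {0..})"
    by (intro continuous_closed_preimage compact_imp_closed closed_atLeast; fact)+
  have "compact (A \<inter> S)"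
    unfolding S_def by (rule compact_Int_closed[OF \<open>compact A\<close> closed_Int[OF cl]])
  moreover have "A \<inter> S = S" by (auto simp: S_def)
  ultimately have "compact S" by (simp only:)
  moreover have "x \<in> S"
    using x e eta by (auto simp: S_def A_def p_def q_def h_def)
  then have "S \<noteq> {}" by blast
  ultimately have "\<exists>z\<in>S. \<forall>y\<in>S. h y \<le> h z"
    by (rule continuous_attains_sup[OF _ _ conth])
  then obtain z where z: "z \<in> S" and z_max: "\<And>y. y \<in> S \<Longrightarrow> h y \<le> h z" by blast
  define y where "y = z + (1 / (2 * M)) *\<^sub>R grad G z"
  have z2: "z \<in> cball w (\<eta> / 2)" "h x \<le> h z" "h z \<le> e"
    and zp: "dist z x \<le> 4 * (\<phi> (h z) - \<phi> (h x))"
    and zq: "(g z)\<^sup>2 \<le> (g x)\<^sup>2 + 12 * M * (h z - h x)"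
    using z by (auto simp: S_def A_def p_def q_def)
  have zw: "z \<in> cball w \<eta>" using z2(1) eta by simp
  have ww: "w \<in> cball w \<eta>" using eta by simp
  have dyz: "dist y z = g z / (2 * M)" using M by (simp add: y_def dist_norm g_def)
  \<comment> \<open>Criticality of \<open>w\<close> bounds the step by half of the distance to
    \<open>w\<close>, so \<open>y\<close> cannot leave the ball of radius \<open>\<eta>\<close>,
    where the KL and Lipschitz bounds hold.\<close>
  have "g z \<le> M * dist w z"
    using lip[OF zw ww] crit by (simp add: g_def dist_norm norm_minus_commute)
  then have "dist y z \<le> dist w z / 2" using M by (simp add: dyz field_simps)
  moreover have "dist w y \<le> dist w z + dist y z" by (metis dist_commute dist_triangle)
  ultimately have yw: "y \<in> cball w \<eta>" using z2(1) eta by simp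
  have step: "h y \<ge> h z + (g z)\<^sup>2 / (4 * M)" and gy: "g y \<le> 2 * g z"
    using ascent_step[OF diff M convex_cball lip zw yw y_def] by (simp_all add: h_def g_def)
  have "1 \<le> deriv \<phi> (h z) * g z" using KLh[OF zw z2(2)] .
  then have "g z \<noteq> 0" by auto
  then have gz: "g z > 0" by (simp add: g_def)
  then have "(g z)\<^sup>2 / (4 * M) > 0" using M by simp
  then have "h y > h z" using step by linarith
  then have hy: "h x \<le> h y" using z2(2) by simp
  have KLy: "1 \<le> deriv \<phi> (h y) * g y" using KLh[OF yw hy] .
  have hyr: "h y \<in> {0<..<r}" using hr[OF yw hy] .
  have dpos: "deriv \<phi> (h y) > 0" using deriv_pos[OF hyr] .
  have "g y \<ge> 0" by (simp add: g_def)
  \<comment> \<open>If the step from the highest point \<open>z\<close> did not pass the level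
    \<open>e\<close>, then \<open>y\<close> would satisfy both bounds as well and lie higher. The
    length bound with \<open>4 * \<phi> e \<le> \<eta> / 4\<close> keeps \<open>y\<close> in the
    half ball.\<close>
  have "h y > e"
  proof (rule ccontr)
    assume "\<not> h y > e"
    then have ye: "h y \<le> e" by simp
    have hzr: "h z \<in> {0<..<r}" using hr[OF zw z2(2)] .
    \<comment> \<open>Concavity bounds the increment of \<open>\<phi>\<close> from below by the
      slope at the upper level, so KL is needed at \<open>y\<close>; the factor 2 between
      \<open>g y\<close> and \<open>g z\<close> carries it back to the step length.\<close>
    have "dist y z / 4 = g z / (8 * M)" by (simp add: dyz)
    also have "\<dots> \<le> (deriv \<phi> (h y) * g y) * (g z / (8 * M))"
      using mult_right_mono[OF KLy, of "g z / (8 * M)"] gz M by simp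
    also have "\<dots> \<le> (deriv \<phi> (h y) * (2 * g z)) * (g z / (8 * M))"
      using gy gz M dpos by (intro mult_right_mono mult_left_mono) auto
    also have "\<dots> = deriv \<phi> (h y) * ((g z)\<^sup>2 / (4 * M))" by (simp add: power2_eq_square)
    also have "\<dots> \<le> deriv \<phi> (h y) * (h y - h z)" using step dpos by (intro mult_left_mono) auto
    also have "\<dots> \<le> \<phi> (h y) - \<phi> (h z)"
      using above_tangent[OF hyr, of "h z"] hzr by (simp add: algebra_simps)
    finally have "dist y z \<le> 4 * (\<phi> (h y) - \<phi> (h z))" by simp
    then have yp: "dist y x \<le> 4 * (\<phi> (h y) - \<phi> (h x))"
      using zp dist_triangle[of y x z] by (simp add: algebra_simps)
    also have "\<dots> \<le> 4 * \<phi> e"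
    proof -
      have "\<phi> (h y) \<le> \<phi> e" using hyr ye e(3) by (subst le_iff) auto
      moreover have "\<phi> (h x) \<ge> 0" using e by (intro nonneg) (auto simp: h_def)
      ultimately show ?thesis by simp
    qed
    finally have "dist w y \<le> \<eta> / 2"
      using e(4) x dist_triangle[of w y x] by (simp add: dist_commute)
    moreover have "(g y)\<^sup>2 \<le> (g x)\<^sup>2 + 12 * M * (h y - h x)"
    proof -
      have "(g y)\<^sup>2 \<le> (2 * g z)\<^sup>2" using gy \<open>g y \<ge> 0\<close> by (rule power_mono)
      also have "\<dots> = (g z)\<^sup>2 + 12 * M * ((g z)\<^sup>2 / (4 * M))"
        using M by (simp add: power2_eq_square)
      also have "\<dots> \<le> ((g x)\<^sup>2 + 12 * M * (h z - h x)) + 12 * M * (h y - h z)"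
        using zq step M by (intro add_mono mult_left_mono) auto
      finally show ?thesis by (simp add: algebra_simps)
    qed
    ultimately have "y \<in> S" using yp hy ye by (simp add: S_def A_def p_def q_def)
    then show False using z_max \<open>h y > h z\<close> by fastforce
  qed
  have er: "e \<in> {0<..<r}" using e by simp
  \<comment> \<open>Above the level \<open>e\<close> the monotonicity of \<open>deriv \<phi>\<close>
    has the right direction. The gradient is compared at \<open>z\<close>, not \<open>y\<close>,
    because the level of \<open>z\<close> is at most \<open>e\<close> and its gradient budget is
    therefore controlled by \<open>e - h x\<close>.\<close>
  have "deriv \<phi> (h y) \<le> deriv \<phi> e" using deriv_antimono[OF er hyr] \<open>h y > e\<close> by simp
  then have "deriv \<phi> (h y) * g y \<le> deriv \<phi> e * (2 * g z)"
    using gy dpos \<open>g y \<ge> 0\<close> by (intro mult_mono) auto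
  then have "1 \<le> deriv \<phi> e * (2 * g z)" using KLy by simp
  then have "1 \<le> (deriv \<phi> e * (2 * g z))\<^sup>2" by (simp add: one_le_power)
  also have "\<dots> = (deriv \<phi> e)\<^sup>2 * (4 * (g z)\<^sup>2)" by (simp add: power_mult_distrib)
  also have "\<dots> \<le> (deriv \<phi> e)\<^sup>2 * (4 * ((g x)\<^sup>2 + 12 * M * (e - h x)))"
  proof -
    have "12 * M * (h z - h x) \<le> 12 * M * (e - h x)"
      using z2(3) M by (intro mult_left_mono) auto
    then show ?thesis using zq by (intro mult_left_mono) auto
  qed
  finally show ?thesis by (simp add: g_def h_def)
qed

text \<open>\<open>e\<close> stands for the energy excess and \<open>n\<close> for the dissipation.
  The constants do not depend on them, so the inequality can be used along a whole trajectory. Three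
  cases arise: \<open>n\<close> is large compared with \<open>e\<close>, or the potential excess is
  at most \<open>e\<close>, or it exceeds \<open>e\<close>.\<close>

lemma (in desing_profile) energy_KL:
  fixes G :: "'a::euclidean_space \<Rightarrow> real"
  assumes C2: "C2_function G" and desing: "desingularizing G w r \<phi>" and crit: "grad G w = 0"
  obtains \<rho> d c where "\<rho> > 0" "0 < d" "d < r" "c > 0"
    and "\<And>x e n. x \<in> cball w \<rho> \<Longrightarrow> 0 < e \<Longrightarrow> e < d \<Longrightarrow> e \<le> G x - G w + n \<Longrightarrow>
      (norm (grad G x))\<^sup>2 \<le> n \<Longrightarrow> c \<le> (deriv \<phi> e)\<^sup>2 * n"
proof -
  have diff: "G differentiable (at y)" for y using C2 by (simp add: C2_function_def)
  obtain \<eta> where \<eta>: "\<eta> > 0" "\<And>x. x \<in> cball w \<eta> \<Longrightarrow> \<bar>G x - G w\<bar> < r"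
    "\<And>x. x \<in> cball w \<eta> \<Longrightarrow> G x \<noteq> G w \<Longrightarrow> 1 \<le> deriv \<phi> \<bar>G x - G w\<bar> * norm (grad G x)"
    using desing_gradient_bound[OF desing diff] by metis
  obtain M where M: "M > 0" "\<And>x y. x \<in> cball w \<eta> \<Longrightarrow> y \<in> cball w \<eta> \<Longrightarrow>
      norm (grad G x - grad G y) \<le> M * norm (x - y)"
    using grad_lipschitz_cball[OF C2] by metis
  obtain \<beta> \<eta>0 where \<beta>: "\<beta> > 0" "\<eta>0 > 0" "\<eta>0 \<le> r"
    "\<And>s. s \<in> {0<..<\<eta>0} \<Longrightarrow> \<beta> / sqrt s \<le> deriv \<phi> s"
    using growth unfolding desing_growth_def by metis
  \<comment> \<open>The bound \<open>\<eta> / 16\<close> yields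
    \<open>4 * \<phi> e \<le> \<eta> / 4\<close> in \<open>gradient_at_higher_level\<close>.\<close>
  obtain d where d: "0 < d" "d < r" "\<And>s. 0 \<le> s \<Longrightarrow> s < d \<Longrightarrow> \<phi> s < \<eta> / 16"
    using small_values[of "\<eta> / 16"] \<eta>(1) by (metis divide_pos_pos zero_less_numeral)
  \<comment> \<open>The first entry is \<open>\<beta>\<^sup>2 / e\<close> times
    \<open>n \<ge> e / 2\<close>; the second comes from the ascent, where the gap
    \<open>e - a\<close> is at most \<open>n\<close>.\<close>
  define c where "c = min (\<beta>\<^sup>2 / 2) (1 / (4 * (1 + 12 * M)))"
  show thesis
  proof (rule that[of "\<eta> / 4" "min d \<eta>0" c])
    fix x e n
    assume x: "x \<in> cball w (\<eta> / 4)" and e: "0 < e" "e < min d \<eta>0"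
      and en: "e \<le> G x - G w + n" and n: "(norm (grad G x))\<^sup>2 \<le> n"
    have er: "e \<in> {0<..<r}" using e d by auto
    have xw: "x \<in> cball w \<eta>" using x \<eta>(1) by simp
    have n0: "0 \<le> n" using n by (metis order_trans zero_le_power2)
    show "c \<le> (deriv \<phi> e)\<^sup>2 * n"
    proof (cases "e \<le> 2 * n")
      case True
      have "(\<beta> / sqrt e)\<^sup>2 \<le> (deriv \<phi> e)\<^sup>2"
        using \<beta> e by (intro power_mono) auto
      then have "(\<beta> / sqrt e)\<^sup>2 * (e / 2) \<le> (deriv \<phi> e)\<^sup>2 * n"
        using True e by (intro mult_mono) auto
      then show ?thesis using e by (simp add: c_def power_divide)
    next
      case False
      \<comment> \<open>Here \<open>n < e / 2\<close>, so the potential excess \<open>a\<close> is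
        more than half of \<open>e\<close> and KL is available at \<open>x\<close>.\<close>
      define a where "a = G x - G w"
      have a: "a > 0" using False en n0 e by (simp add: a_def)
      have ar: "a \<in> {0<..<r}" using \<eta>(2)[OF xw] a by (simp add: a_def)
      have "1 \<le> (deriv \<phi> e)\<^sup>2 * (4 * ((1 + 12 * M) * n))"
      proof (cases "a \<le> e")
        case True
        have "1 \<le> (deriv \<phi> e)\<^sup>2 * (4 * ((norm (grad G x))\<^sup>2 + 12 * M * (e - a)))"
          unfolding a_def
          by (rule gradient_at_higher_level[OF C2 M crit \<eta>(2,3) x])
            (use a True er d(3)[of e] e in \<open>auto simp: a_def\<close>)
        also have "\<dots> \<le> (deriv \<phi> e)\<^sup>2 * (4 * (n + 12 * M * n))"
          using n en M(1) by (intro mult_left_mono add_mono) (auto simp: a_def)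
        finally show ?thesis by (simp add: algebra_simps)
      next
        case False
        then have "deriv \<phi> a \<le> deriv \<phi> e" using deriv_antimono[OF er ar] by simp
        moreover have "1 \<le> deriv \<phi> a * norm (grad G x)" using \<eta>(3)[OF xw] a by (simp add: a_def)
        ultimately have "1 \<le> deriv \<phi> e * norm (grad G x)"
          by (meson mult_right_mono norm_ge_zero order_trans)
        then have "1 \<le> (deriv \<phi> e * norm (grad G x))\<^sup>2" by (simp add: one_le_power)
        also have "\<dots> \<le> (deriv \<phi> e)\<^sup>2 * n" using n by (simp add: power_mult_distrib mult_left_mono)
        also have "\<dots> \<le> (deriv \<phi> e)\<^sup>2 * (4 * ((1 + 12 * M) * n))"
          using n0 M(1) by (intro mult_left_mono) (auto simp: algebra_simps)
        finally show ?thesis .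
      qed
      then have "1 / (4 * (1 + 12 * M)) \<le> (deriv \<phi> e)\<^sup>2 * n"
        using M(1) by (simp add: field_simps)
      then show ?thesis by (simp add: c_def)
    qed
  qed (use \<eta> d \<beta> M in \<open>auto simp: c_def\<close>)
qed

section \<open>Dissipation along bounded trajectories\<close>

text \<open>Restricting to \<open>t > 0\<close> turns the one-sided derivatives of
  \<open>damped_solution\<close> into two-sided ones.\<close>

locale bounded_damped_trajectory =
  fixes \<gamma> :: real and G :: "'a::euclidean_space \<Rightarrow> real" and u u' u'' :: "real \<Rightarrow> 'a"
  assumes damping: "\<gamma> > 0"
    and C2: "C2_function G"
    and u_deriv: "t > 0 \<Longrightarrow> (u has_vector_derivative u' t) (at t)"
    and u'_deriv: "t > 0 \<Longrightarrow> (u' has_vector_derivative u'' t) (at t)"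
    and ode: "t > 0 \<Longrightarrow> u'' t = - \<gamma> *\<^sub>R u' t - grad G (u t)"
    and bounded_orbit: "bounded (u ` {0<..})"
begin

definition dissipation :: "real \<Rightarrow> real" where
  "dissipation t = (norm (u' t))\<^sup>2 + (norm (grad G (u t)))\<^sup>2"

lemma dissipation_nonneg: "dissipation t \<ge> 0"
  by (simp add: dissipation_def)

lemma grad_le_dissipation: "(norm (grad G (u t)))\<^sup>2 \<le> dissipation t"
  by (simp add: dissipation_def)

lemma u'_le_dissipation: "norm (u' t) \<le> sqrt (dissipation t)"
  by (simp add: dissipation_def real_le_rsqrt)

lemma u''_le_dissipation: "t > 0 \<Longrightarrow> norm (u'' t) \<le> (\<gamma> + 1) * sqrt (dissipation t)"
proof -
  assume "t > 0"
  then have "norm (u'' t) \<le> \<gamma> * norm (u' t) + norm (grad G (u t))"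
    using norm_triangle_ineq4[of "- \<gamma> *\<^sub>R u' t" "grad G (u t)"] damping by (simp add: ode)
  also have "\<dots> \<le> \<gamma> * sqrt (dissipation t) + sqrt (dissipation t)"
    using u'_le_dissipation grad_le_dissipation damping by (intro add_mono mult_left_mono) (auto simp: real_le_rsqrt)
  finally show ?thesis by (simp add: algebra_simps)
qed

lemma isCont_u: "t > 0 \<Longrightarrow> isCont u t"
  using u_deriv has_vector_derivative_continuous by blast

text \<open>The energy \<open>norm (u' t)\<^sup>2 / 2 + G (u t)\<close> alone dissipates only the velocity. Adding a
  small multiple \<open>\<mu>\<close> of \<open>grad G (u t) \<bullet> u' t\<close> makes it dissipate the gradient as well.\<close>

lemma strict_Lyapunov:
  obtains E E' \<alpha> B where "\<alpha> > 0"
    and "\<And>t. t > 0 \<Longrightarrow> (E has_real_derivative E' t) (at t)"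
    and "\<And>t. t > 0 \<Longrightarrow> E' t \<le> - \<alpha> * dissipation t"
    and "\<And>t. \<bar>E t - G (u t)\<bar> \<le> dissipation t"
    and "\<And>t. t > 0 \<Longrightarrow> B \<le> E t"
proof -
  obtain H where diff: "\<And>x. G differentiable (at x)"
    and H: "\<And>x. (grad G has_derivative blinfun_apply (H x)) (at x)"
    and HM: "\<And>w R. \<exists>M>0. \<forall>x\<in>cball w R. norm (H x) \<le> M"
    using C2_functionE[OF C2] by metis
  obtain R where R: "\<And>t. t > 0 \<Longrightarrow> u t \<in> cball 0 R"
    using bounded_orbit unfolding bounded_iff by auto
  obtain M where M: "M > 0" "\<And>t. t > 0 \<Longrightarrow> norm (H (u t)) \<le> M"
    using HM[of 0 R] R by blast
  \<comment> \<open>With \<open>\<mu> \<le> 1\<close> the mixed term is at most half of the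
    dissipation, which controls \<open>E t - G (u t)\<close>. The other bound keeps the velocity
    terms created by differentiating the mixed term,
    \<open>\<mu> * (M + \<gamma>\<^sup>2 / 2)\<close> in total, below half of the damping.\<close>
  define \<mu> where "\<mu> = min 1 (\<gamma> / (2 * (M + \<gamma>\<^sup>2 / 2 + 1)))"
  have pos: "M + \<gamma>\<^sup>2 / 2 + 1 > 0" using M by (simp add: add_pos_nonneg)
  have \<mu>: "\<mu> > 0" "\<mu> \<le> 1" using damping pos by (auto simp: \<mu>_def)
  have "\<mu> \<le> \<gamma> / (2 * (M + \<gamma>\<^sup>2 / 2 + 1))" by (simp add: \<mu>_def)
  then have \<mu>2: "\<mu> * (M + \<gamma>\<^sup>2 / 2 + 1) \<le> \<gamma> / 2" using pos by (simp add: field_simps)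
  define g where "g t = grad G (u t)" for t
  define E where "E t = inner (u' t) (u' t) / 2 + G (u t) + \<mu> * inner (g t) (u' t)" for t
  define E' where "E' t = inner (u' t) (u'' t) + inner (u' t) (g t)
    + \<mu> * (inner (g t) (u'' t) + inner (H (u t) (u' t)) (u' t))" for t
  have cross: "\<bar>inner (g t) (u' t)\<bar> \<le> (norm (u' t))\<^sup>2 / 2 + (norm (g t))\<^sup>2 / 2" for t
    using Cauchy_Schwarz_ineq2[of "g t" "u' t"] sum_squares_bound[of "norm (g t)" "norm (u' t)"] by simp
  have cross_\<mu>: "\<bar>\<mu> * inner (g t) (u' t)\<bar> \<le> (norm (u' t))\<^sup>2 / 2 + (norm (g t))\<^sup>2 / 2" for t
    using mult_mono[OF \<mu>(2) cross[of t]] \<mu> by (simp add: abs_mult)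
  have "(E has_real_derivative E' t) (at t)" if t: "t > 0" for t
  proof -
    have Gu: "((\<lambda>t. G (u t)) has_real_derivative inner (u' t) (g t)) (at t)"
      using has_derivative_compose[OF u_deriv[OF t, unfolded has_vector_derivative_def]
          GDERIV_grad[OF diff, unfolded gderiv_def]]
      by (rule has_derivative_imp_has_field_derivative) (simp add: g_def)
    have g': "(g has_derivative (\<lambda>h. h *\<^sub>R H (u t) (u' t))) (at t)"
      using has_derivative_compose[OF u_deriv[OF t, unfolded has_vector_derivative_def] H]
      unfolding g_def by (simp add: blinfun.scaleR_right)
    have u'd: "(u' has_derivative (\<lambda>h. h *\<^sub>R u'' t)) (at t)"
      using u'_deriv[OF t] by (simp add: has_vector_derivative_def)
    have 1: "((\<lambda>t. inner (u' t) (u' t)) has_real_derivative 2 * inner (u' t) (u'' t)) (at t)"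
      using has_derivative_inner[OF u'd u'd]
      by (rule has_derivative_imp_has_field_derivative) (simp add: inner_commute)
    have 2: "((\<lambda>t. inner (g t) (u' t)) has_real_derivative
        inner (g t) (u'' t) + inner (H (u t) (u' t)) (u' t)) (at t)"
      using has_derivative_inner[OF g' u'd]
      by (rule has_derivative_imp_has_field_derivative) (simp add: algebra_simps)
    show ?thesis
      unfolding E_def E'_def by (auto intro!: derivative_eq_intros 1 2 Gu)
  qed
  moreover have "E' t \<le> - (\<mu> / 2) * dissipation t" if t: "t > 0" for t
  proof -
    have "norm (H (u t) (u' t)) \<le> M * norm (u' t)"
      using norm_blinfun[of "H (u t)" "u' t"] M(2)[OF t] by (meson mult_right_mono norm_ge_zero order_trans)
    then have "\<bar>inner (H (u t) (u' t)) (u' t)\<bar> \<le> M * (norm (u' t))\<^sup>2"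
      using Cauchy_Schwarz_ineq2[of "H (u t) (u' t)" "u' t"]
      by (smt (verit) mult.assoc mult_right_mono norm_ge_zero power2_eq_square)
    then have h: "\<mu> * inner (H (u t) (u' t)) (u' t) \<le> \<mu> * (M * (norm (u' t))\<^sup>2)"
      using \<mu> by (intro mult_left_mono) auto
    \<comment> \<open>Young's inequality with \<open>\<gamma>\<close> put on the velocity: it uses
      up half of \<open>\<mu> * (norm (g t))\<^sup>2\<close> and leaves the other half as
      dissipation of the gradient.\<close>
    have "2 * \<bar>inner (g t) (\<gamma> *\<^sub>R u' t)\<bar> \<le> (norm (g t))\<^sup>2 + (\<gamma> * norm (u' t))\<^sup>2"
      using Cauchy_Schwarz_ineq2[of "g t" "\<gamma> *\<^sub>R u' t"] sum_squares_bound[of "norm (g t)" "\<gamma> * norm (u' t)"] damping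
      by simp
    then have "- (\<gamma> * inner (g t) (u' t)) \<le> (norm (g t))\<^sup>2 / 2 + \<gamma>\<^sup>2 / 2 * (norm (u' t))\<^sup>2"
      by (simp add: power_mult_distrib)
    then have c: "\<mu> * - (\<gamma> * inner (g t) (u' t)) \<le> \<mu> * ((norm (g t))\<^sup>2 / 2 + \<gamma>\<^sup>2 / 2 * (norm (u' t))\<^sup>2)"
      using \<mu> by (intro mult_left_mono) auto
    have "E' t = - \<gamma> * (norm (u' t))\<^sup>2 + \<mu> * - (\<gamma> * inner (g t) (u' t)) - \<mu> * (norm (g t))\<^sup>2
        + \<mu> * inner (H (u t) (u' t)) (u' t)"
      unfolding E'_def ode[OF t] g_def[symmetric]
      by (simp add: inner_diff_right power2_norm_eq_inner algebra_simps inner_commute)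
    also have "\<dots> \<le> - \<gamma> * (norm (u' t))\<^sup>2 + \<mu> * ((norm (g t))\<^sup>2 / 2 + \<gamma>\<^sup>2 / 2 * (norm (u' t))\<^sup>2)
        - \<mu> * (norm (g t))\<^sup>2 + \<mu> * (M * (norm (u' t))\<^sup>2)"
      using h c by linarith
    also have "\<dots> = (\<mu> * (M + \<gamma>\<^sup>2 / 2 + 1) - \<gamma> - \<mu>) * (norm (u' t))\<^sup>2 - (\<mu> / 2) * (norm (g t))\<^sup>2"
      by (simp add: algebra_simps)
    also have "\<dots> \<le> (- (\<mu> / 2)) * (norm (u' t))\<^sup>2 - (\<mu> / 2) * (norm (g t))\<^sup>2"
      using \<mu>2 damping \<mu> by (intro diff_right_mono mult_right_mono) auto
    also have "\<dots> = - (\<mu> / 2) * dissipation t" by (simp add: dissipation_def g_def algebra_simps)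
    finally show ?thesis .
  qed
  moreover have "\<bar>E t - G (u t)\<bar> \<le> dissipation t" for t
  proof -
    have "E t - G (u t) = (norm (u' t))\<^sup>2 / 2 + \<mu> * inner (g t) (u' t)"
      by (simp add: E_def power2_norm_eq_inner)
    then have "\<bar>E t - G (u t)\<bar> \<le> (norm (u' t))\<^sup>2 / 2 + ((norm (u' t))\<^sup>2 / 2 + (norm (g t))\<^sup>2 / 2)"
      using cross_\<mu>[of t] by (simp add: abs_le_iff) (smt (verit) zero_le_power2)
    also have "\<dots> \<le> dissipation t" by (simp add: dissipation_def g_def)
    finally show ?thesis .
  qed
  moreover obtain B where "\<And>t. t > 0 \<Longrightarrow> B \<le> E t"
  proof -
    \<comment> \<open>The kinetic term absorbs the velocity part of the mixed term, so
      \<open>E\<close> is bounded below by a continuous function of the position alone, without an a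
      priori bound on the velocity.\<close>
    have "continuous_on (cball 0 R) (\<lambda>x. G x - (norm (grad G x))\<^sup>2 / 2)"
      by (intro continuous_intros continuous_on_subset[OF continuous_C2[OF C2]]
          continuous_on_subset[OF continuous_grad_C2[OF C2]]) auto
    then have "bounded ((\<lambda>x. G x - (norm (grad G x))\<^sup>2 / 2) ` cball 0 R)"
      by (intro compact_imp_bounded compact_continuous_image) auto
    then obtain B where B0: "\<forall>x\<in>cball 0 R. \<bar>G x - (norm (grad G x))\<^sup>2 / 2\<bar> \<le> B"
      unfolding bounded_iff by (auto simp del: mem_cball)
    then have B: "- B \<le> G (u t) - (norm (g t))\<^sup>2 / 2" if "t > 0" for t
      using bspec[OF B0 R[OF that]] unfolding g_def by linarith
    have "- B \<le> E t" if "t > 0" for t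
    proof -
      have "E t = (norm (u' t))\<^sup>2 / 2 + G (u t) + \<mu> * inner (g t) (u' t)"
        by (simp add: E_def power2_norm_eq_inner)
      then show ?thesis using B[OF that] cross_\<mu>[of t] by linarith
    qed
    then show ?thesis using that by blast
  qed
  ultimately show thesis using that[of "\<mu> / 2" E E' B] \<mu> by simp
qed

text \<open>As \<open>E\<close> cannot fall below \<open>B\<close>, the dissipation becomes
  arbitrarily small at arbitrarily late times. At such times \<open>E\<close> is close to
  \<open>G (u t)\<close>, which identifies the limit of \<open>E\<close> along a convergent
  subsequence; monotonicity extends it to all times.\<close>

lemma Lyapunov_limit:
  assumes \<alpha>: "\<alpha> > 0"
    and E': "\<And>t. t > 0 \<Longrightarrow> (E has_real_derivative E' t) (at t)"
    and decay: "\<And>t. t > 0 \<Longrightarrow> E' t \<le> - \<alpha> * dissipation t"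
    and near: "\<And>t. \<bar>E t - G (u t)\<bar> \<le> dissipation t"
    and B: "\<And>t. t > 0 \<Longrightarrow> B \<le> E t"
  obtains w s where "grad G w = 0" "filterlim s at_top sequentially" "(\<lambda>k. u (s k)) \<longlonglongrightarrow> w"
    and "antimono_on {0<..} E" "(E \<longlongrightarrow> G w) at_top" "\<And>t. t > 0 \<Longrightarrow> G w \<le> E t"
proof -
  have slope: "E t - E s \<le> - (\<alpha> * \<epsilon>) * (t - s)"
    if "0 < s" "s \<le> t" and dis: "\<And>x. s \<le> x \<Longrightarrow> \<epsilon> \<le> dissipation x" for s t \<epsilon>
  proof (cases "s = t")
    case False
    then have "s < t" using that(2) by simp
    moreover have "(E has_real_derivative E' x) (at x)" if "s \<le> x" for x
      using E' \<open>0 < s\<close> that by simp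
    ultimately obtain z where z: "s < z" "z < t" "E t - E s = (t - s) * E' z"
      using MVT2[of s t E E'] by blast
    have "E' z \<le> - (\<alpha> * dissipation z)" using decay[of z] that z by simp
    also have "\<dots> \<le> - (\<alpha> * \<epsilon>)" using \<alpha> dis[of z] z by simp
    finally have "(t - s) * E' z \<le> (t - s) * - (\<alpha> * \<epsilon>)"
      using that(2) by (intro mult_left_mono) auto
    then show ?thesis using z(3) by (simp add: mult.commute)
  qed simp
  have anti: "antimono_on {0<..} E"
    using slope[where \<epsilon>=0] dissipation_nonneg by (intro monotone_onI) fastforce
  have "\<exists>t\<ge>real k + 1. dissipation t < 1 / (real k + 1)" for k
  proof (rule ccontr)
    define T where "T = real k + 1"
    assume "\<not> ?thesis"
    then have dis: "\<And>x. T \<le> x \<Longrightarrow> 1 / T \<le> dissipation x" by (auto simp: T_def not_less)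
    have T: "T > 0" by (simp add: T_def)
    \<comment> \<open>At slope \<open>- \<alpha> / T\<close> the energy would lose exactly
      \<open>E T - B + 1\<close> up to this time, one more than it can.\<close>
    define t where "t = T + T * (E T - B + 1) / \<alpha>"
    have tT: "t \<ge> T" using B[OF T] \<alpha> T by (simp add: t_def)
    have "B - E T \<le> E t - E T" using B[of t] tT T by simp
    also have "\<dots> \<le> - (\<alpha> * (1 / T)) * (t - T)" using slope[OF T tT dis] .
    also have "\<dots> = - (E T - B + 1)" using \<alpha> T by (simp add: t_def)
    finally show False by simp
  qed
  then obtain \<tau> where \<tau>: "\<And>k. \<tau> k \<ge> real k + 1" "\<And>k. dissipation (\<tau> k) < 1 / (real k + 1)" by metis
  have \<tau>_lim: "filterlim \<tau> at_top sequentially"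
    by (rule filterlim_at_top_mono[OF filterlim_real_sequentially])
      (use \<tau>(1) in \<open>auto intro!: always_eventually order_trans[OF _ \<tau>(1)]\<close>)
  have dis_\<tau>: "(\<lambda>k. dissipation (\<tau> k)) \<longlonglongrightarrow> 0"
  proof (rule tendsto_sandwich[OF _ _ tendsto_const])
    show "(\<lambda>k. 1 / (real k + 1)) \<longlonglongrightarrow> 0"
      using LIMSEQ_inverse_real_of_nat by (simp add: inverse_eq_divide add.commute)
  qed (use dissipation_nonneg \<tau>(2) in \<open>auto intro!: always_eventually less_imp_le\<close>)
  have \<tau>0: "\<tau> k > 0" for k using \<tau>(1)[of k] by linarith
  have "compact (closure (u ` {0<..}))" using bounded_orbit by (simp add: compact_closure)
  moreover have "\<forall>k. u (\<tau> k) \<in> closure (u ` {0<..})"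
    using \<tau>0 closure_subset by (metis greaterThan_iff image_eqI subsetD)
  ultimately obtain w \<sigma> where \<sigma>: "strict_mono \<sigma>" "((\<lambda>k. u (\<tau> k)) \<circ> \<sigma>) \<longlonglongrightarrow> w"
    unfolding compact_def by metis
  define s where "s = \<tau> \<circ> \<sigma>"
  have s_lim: "filterlim s at_top sequentially"
    unfolding s_def comp_def by (rule filterlim_compose[OF \<tau>_lim filterlim_subseq[OF \<sigma>(1)]])
  have us: "(\<lambda>k. u (s k)) \<longlonglongrightarrow> w" using \<sigma>(2) by (simp add: s_def comp_def)
  have ds: "(\<lambda>k. dissipation (s k)) \<longlonglongrightarrow> 0"
    using LIMSEQ_subseq_LIMSEQ[OF dis_\<tau> \<sigma>(1)] by (simp add: s_def comp_def)
  have "(\<lambda>k. grad G (u (s k))) \<longlonglongrightarrow> grad G w"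
    by (rule continuous_on_tendsto_compose[OF continuous_grad_C2[OF C2] us]) auto
  then have "(\<lambda>k. (norm (grad G (u (s k))))\<^sup>2) \<longlonglongrightarrow> (norm (grad G w))\<^sup>2"
    by (intro tendsto_intros)
  from LIMSEQ_le[OF this ds] have "(norm (grad G w))\<^sup>2 \<le> 0" using grad_le_dissipation by blast
  then have crit: "grad G w = 0" by simp
  have Gs: "(\<lambda>k. G (u (s k))) \<longlonglongrightarrow> G w"
    by (rule continuous_on_tendsto_compose[OF continuous_C2[OF C2] us]) auto
  have "(\<lambda>k. E (s k) - G (u (s k))) \<longlonglongrightarrow> 0"
    by (rule Lim_null_comparison[OF _ ds]) (use near in auto)
  from tendsto_add[OF this Gs] have Es: "(\<lambda>k. E (s k)) \<longlonglongrightarrow> G w" by simp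
  have lower: "G w \<le> E t" if t: "t > 0" for t
  proof (rule tendsto_upperbound[OF Es])
    have "\<forall>\<^sub>F k in sequentially. s k \<ge> t" using s_lim by (simp add: filterlim_at_top)
    then show "\<forall>\<^sub>F k in sequentially. E (s k) \<le> E t"
      by eventually_elim (use anti t in \<open>auto simp: monotone_on_def\<close>)
  qed simp
  have "(E \<longlongrightarrow> G w) at_top"
  proof (rule order_tendstoI)
    fix a assume a: "a < G w"
    show "\<forall>\<^sub>F t in at_top. a < E t"
      using eventually_gt_at_top[of "0::real"] by eventually_elim (use lower a in fastforce)
  next
    fix a assume "G w < a"
    then have "\<forall>\<^sub>F k in sequentially. E (s k) < a \<and> s k > 0"
      using order_tendstoD(2)[OF Es] s_lim by (auto simp: filterlim_at_top_dense eventually_conj_iff)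
    then obtain k where k: "E (s k) < a" "s k > 0" by (auto simp: eventually_sequentially)
    show "\<forall>\<^sub>F t in at_top. E t < a"
      using eventually_ge_at_top[of "s k"]
    proof eventually_elim
      case (elim t)
      then have "E t \<le> E (s k)" using anti k by (auto simp: monotone_on_def)
      then show ?case using k by simp
    qed
  qed
  then show thesis using that crit s_lim us anti lower by blast
qed

end

section \<open>Trapping near a critical point\<close>

text \<open>\<open>P'\<close> need not be continuous, so it is not integrated. Instead
  \<open>P\<close> is compared with an antiderivative \<open>Q\<close> of the norm:
  \<open>Q + P\<close> is nonincreasing from \<open>T\<close> on, which bounds \<open>Q\<close> and
  lets it converge.\<close>

lemma absolutely_integrable_on_halfline_bounded_by_derivative:
  fixes f :: "real \<Rightarrow> 'a::euclidean_space" and P :: "real \<Rightarrow> real"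
  assumes contf: "continuous_on {0..} f" and T: "T \<ge> 0"
    and P': "\<And>t. t \<ge> T \<Longrightarrow> (P has_real_derivative P' t) (at t)"
    and le: "\<And>t. t \<ge> T \<Longrightarrow> norm (f t) \<le> - P' t"
    and nonneg: "\<And>t. t \<ge> T \<Longrightarrow> 0 \<le> P t"
  shows "f absolutely_integrable_on {0<..}"
proof -
  \<comment> \<open>A constant extension to negative times makes the function continuous on the
    whole line, so that \<open>Q\<close> has a two-sided derivative at 0 too.\<close>
  define g where "g t = f (max 0 t)" for t
  have contg: "continuous_on UNIV g"
    unfolding g_def by (rule continuous_on_compose2[OF contf]) (auto intro!: continuous_intros)
  have contn: "continuous_on UNIV (\<lambda>t. norm (g t))" by (intro continuous_intros contg)
  obtain Q where Q: "\<And>t. (Q has_real_derivative norm (g t)) (at t)"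
    using einterval_antiderivative[of "-\<infinity>" "\<infinity>" "\<lambda>t. norm (g t)"] contn
    by (auto simp: continuous_on_eq_continuous_at has_real_derivative_iff_has_vector_derivative)
  have monoQ: "Q s \<le> Q t" if "s \<le> t" for s t
    using that by (rule DERIV_nonneg_imp_nondecreasing) (use Q norm_ge_zero in blast)
  have bound: "Q t \<le> Q T + P T" for t
  proof (cases "t \<le> T")
    case True
    then show ?thesis using monoQ[OF True] nonneg[of T] by simp
  next
    case False
    have "Q t + P t \<le> Q T + P T"
    proof (rule DERIV_nonpos_imp_nonincreasing[of T t "\<lambda>t. Q t + P t"])
      fix x assume x: "T \<le> x" "x \<le> t"
      have "((\<lambda>t. Q t + P t) has_real_derivative norm (g x) + P' x) (at x)"
        by (intro DERIV_add Q P' x)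
      moreover have "norm (g x) + P' x \<le> 0" using le[OF x(1)] x T by (simp add: g_def max_def)
      ultimately show "\<exists>y. ((\<lambda>t. Q t + P t) has_real_derivative y) (at x) \<and> y \<le> 0" by blast
    qed (use False in simp)
    then show ?thesis using nonneg[of t] False by simp
  qed
  define L where "L = (SUP t. Q t)"
  have bdd: "bdd_above (range Q)" using bound by (auto intro!: bdd_aboveI)
  have "(Q \<longlongrightarrow> L) at_top"
  proof (rule order_tendstoI)
    fix a assume "a < L"
    then obtain s where s: "a < Q s" unfolding L_def using less_cSUP_iff[OF _ bdd] by auto
    show "\<forall>\<^sub>F t in at_top. a < Q t"
      using eventually_ge_at_top[of s] by eventually_elim (use s monoQ in fastforce)
  next
    fix a assume "L < a"
    then have "Q t < a" for t using cSUP_upper[OF _ bdd, of t] by (simp add: L_def)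
    then show "\<forall>\<^sub>F t in at_top. Q t < a" by simp
  qed
  then have "(\<integral>\<^sup>+x. ennreal (norm (g x)) * indicator {0..} x \<partial>lborel) = L - Q 0"
    using contn Q by (intro nn_integral_FTC_atLeast) (auto intro: borel_measurable_continuous_onI)
  then have "(\<integral>\<^sup>+x. ennreal (norm (indicator {0..} x *\<^sub>R g x)) \<partial>lborel) < \<infinity>"
    by (simp add: ennreal_mult' mult.commute ennreal_indicator[symmetric])
  moreover have "g \<in> borel_measurable borel" using contg by (rule borel_measurable_continuous_onI)
  ultimately have int: "integrable lborel (\<lambda>x. indicator {0..} x *\<^sub>R g x)"
    by (intro integrableI_bounded) auto
  then have "g absolutely_integrable_on {0..}"
    unfolding set_integrable_def
    by (simp add: integrable_completion[OF borel_measurable_integrable[OF int]])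
  then have "g absolutely_integrable_on {0<..}"
    by (rule set_integrable_subset) auto
  moreover have "g absolutely_integrable_on {0<..} \<longleftrightarrow> f absolutely_integrable_on {0<..}"
    by (rule set_integrable_cong) (auto simp: g_def)
  ultimately show ?thesis by simp
qed

section \<open>The stationary case and the trapping argument\<close>

context bounded_damped_trajectory
begin

text \<open>This settles the degenerate case in which the energy excess reaches 0, where
  \<open>deriv \<phi>\<close> is not controlled. From then on the energy is constant, so nothing
  dissipates and the trajectory rests at its limit point.\<close>

lemma stationary_after_equality:
  assumes \<alpha>: "\<alpha> > 0"
    and E': "\<And>t. t > 0 \<Longrightarrow> (E has_real_derivative E' t) (at t)"
    and decay: "\<And>t. t > 0 \<Longrightarrow> E' t \<le> - \<alpha> * dissipation t"
    and s: "filterlim s at_top sequentially" "(\<lambda>k. u (s k)) \<longlonglongrightarrow> w"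
    and anti: "antimono_on {0<..} E" and lower: "\<And>t. t > 0 \<Longrightarrow> l \<le> E t"
    and T: "T > 0" "E T = l"
  shows "t > T \<Longrightarrow> dissipation t = 0" and "t > T \<Longrightarrow> u t = w"
proof -
  have const: "E t = l" if "t > T" for t
    using monotone_onD[OF anti, of T t] lower[of t] that T by simp
  show dis: "dissipation t = 0" if t: "t > T" for t
  proof -
    have "(E has_real_derivative 0) (at t)"
      by (rule has_field_derivative_transform_within_open[of "\<lambda>_. l" 0 t "{T<..}"])
        (use t const in auto)
    then have "E' t = 0" using E'[of t] t T DERIV_unique by force
    then show ?thesis
      using decay[of t] t T \<alpha> dissipation_nonneg[of t]
      by (simp add: mult_le_0_iff)
  qed
  obtain c where c: "\<And>t. t \<in> {T<..} \<Longrightarrow> u t = c"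
  proof -
    have "(u has_vector_derivative 0) (at t within {T<..})" if t: "t \<in> {T<..}" for t
    proof -
      have "u' t = 0" using dis[of t] t u'_le_dissipation[of t] by simp
      then show ?thesis using u_deriv[of t] t T has_vector_derivative_at_within by force
    qed
    then have "\<exists>c. \<forall>t\<in>{T<..}. u t = c"
      by (intro has_derivative_zero_constant) (auto simp: has_vector_derivative_def)
    then show ?thesis using that by blast
  qed
  have "\<forall>\<^sub>F k in sequentially. u (s k) = c"
    using s(1)[unfolded filterlim_at_top_dense, rule_format, of T] by eventually_elim (use c in simp)
  then have "(\<lambda>k. u (s k)) \<longlonglongrightarrow> c" by (rule tendsto_eventually)
  then have "c = w" using s(2) LIMSEQ_unique by blast
  then show "t > T \<Longrightarrow> u t = w" using c by simp
qed

text \<open>The KL bootstrap: the length bound is valid only inside the ball of radius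
  \<open>\<rho>\<close>, and it is what keeps the trajectory inside. The starting time is a late
  \<open>s k\<close>, at which the distance to \<open>w\<close> and the bound on the remaining
  length are both below \<open>\<rho> / 4\<close>.\<close>

lemma trapped_near_critical_point:
  assumes \<alpha>: "\<alpha> > 0"
    and E': "\<And>t. t > 0 \<Longrightarrow> (E has_real_derivative E' t) (at t)"
    and decay: "\<And>t. t > 0 \<Longrightarrow> E' t \<le> - \<alpha> * dissipation t"
    and near: "\<And>t. \<bar>E t - G (u t)\<bar> \<le> dissipation t"
    and crit: "grad G w = 0"
    and s: "filterlim s at_top sequentially" "(\<lambda>k. u (s k)) \<longlonglongrightarrow> w"
    and anti: "antimono_on {0<..} E" and E_lim: "(E \<longlongrightarrow> G w) at_top"
    and lower: "\<And>t. t > 0 \<Longrightarrow> G w < E t"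
    and desing: "desingularizing G w r \<phi>" and growth: "desing_growth r \<phi>"
  obtains T c K where "T > 0" "c > 0" "K > 0"
    and "\<And>t. t \<ge> T \<Longrightarrow> E t - G w \<in> {0<..<r}"
    and "\<And>t. t \<ge> T \<Longrightarrow> c \<le> (deriv \<phi> (E t - G w))\<^sup>2 * dissipation t"
    and "\<And>t. t \<ge> T \<Longrightarrow> sqrt (dissipation t) \<le> - (K * (deriv \<phi> (E t - G w) * E' t))"
    and "\<And>t. t \<ge> T \<Longrightarrow> norm (u t - w) \<le> K * \<phi> (E t - G w)"
proof -
  interpret desing_profile r \<phi> using desing growth by (rule desing_profileI)
  obtain \<rho> d c where \<rho>: "\<rho> > 0" and d: "0 < d" "d < r" and c: "c > 0"
    and KL: "\<And>x e n. x \<in> cball w \<rho> \<Longrightarrow> 0 < e \<Longrightarrow> e < d \<Longrightarrow> e \<le> G x - G w + n \<Longrightarrow>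
      (norm (grad G x))\<^sup>2 \<le> n \<Longrightarrow> c \<le> (deriv \<phi> e)\<^sup>2 * n"
    using energy_KL[OF C2 desing crit] by metis
  \<comment> \<open>If \<open>n\<close> is the root of the dissipation, then
    \<open>sqrt c \<le> deriv \<phi> (e t) * n\<close> and
    \<open>\<alpha> * n\<^sup>2 \<le> - E' t\<close>; multiplying the first by \<open>n\<close>
    gives the speed bound with this \<open>K\<close>.\<close>
  define K where "K = 1 / (\<alpha> * sqrt c)"
  have K: "K > 0" using \<alpha> c by (simp add: K_def)
  obtain d' where d': "0 < d'" "d' < r" "\<And>x. 0 \<le> x \<Longrightarrow> x < d' \<Longrightarrow> \<phi> x < \<rho> / (4 * K)"
    using small_values[of "\<rho> / (4 * K)"] K \<rho> by (metis divide_pos_pos mult_pos_pos zero_less_numeral)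
  define e where "e t = E t - G w" for t
  have "\<forall>\<^sub>F t in at_top. E t < G w + min d d'"
    using E_lim by (rule order_tendstoD) (use d d' in auto)
  then have "\<forall>\<^sub>F k in sequentially. E (s k) < G w + min d d'"
    using s(1) by (rule eventually_compose_filterlim)
  moreover have "\<forall>\<^sub>F k in sequentially. dist (u (s k)) w < \<rho> / 4"
    using s(2) \<rho> by (intro tendstoD) auto
  moreover have "\<forall>\<^sub>F k in sequentially. s k > 0"
    using s(1) by (simp add: filterlim_at_top_dense)
  ultimately have "\<forall>\<^sub>F k in sequentially. E (s k) < G w + min d d' \<and> dist (u (s k)) w < \<rho> / 4 \<and> s k > 0"
    by eventually_elim simp
  then obtain k where "E (s k) < G w + min d d' \<and> dist (u (s k)) w < \<rho> / 4 \<and> s k > 0"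
    unfolding eventually_sequentially by (meson order_refl)
  then obtain T where T: "T > 0" "dist (u T) w < \<rho> / 4" "e T < min d d'"
    by (intro that[of "s k"]) (auto simp: e_def)
  have e: "0 < e t" "e t < min d d'" "e t \<in> {0<..<r}" if "t \<ge> T" for t
  proof -
    have "e t \<le> e T" using monotone_onD[OF anti, of T t] that T by (simp add: e_def)
    then show "0 < e t" "e t < min d d'" "e t \<in> {0<..<r}"
      using T lower[of t] that d by (auto simp: e_def)
  qed
  have \<phi>e: "0 \<le> K * \<phi> (e t)" "K * \<phi> (e t) < \<rho> / 4" if "t \<ge> T" for t
    using nonneg[of "e t"] d'(3)[of "e t"] e[OF that] K by (auto simp: field_simps)
  define P' where "P' t = K * (deriv \<phi> (e t) * E' t)" for t
  have P: "((\<lambda>t. K * \<phi> (e t)) has_real_derivative P' t) (at t)" if "t \<ge> T" for t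
    unfolding P'_def e_def
    using that T e(3)[OF that] E'[of t]
    by (intro DERIV_cmult DERIV_chain2[where f=\<phi>] has_deriv) (auto intro!: derivative_eq_intros simp: e_def)
  have KLt: "c \<le> (deriv \<phi> (e t))\<^sup>2 * dissipation t" if "t \<ge> T" "u t \<in> cball w \<rho>" for t
    using that e[OF that(1)] near[of t] grad_le_dissipation[of t]
    by (intro KL[of "u t" "e t" "dissipation t"]) (auto simp: e_def)
  have speed: "sqrt (dissipation t) \<le> - P' t" if t: "t \<ge> T" "u t \<in> cball w \<rho>" for t
  proof -
    define n where "n = sqrt (dissipation t)"
    have n: "n \<ge> 0" "dissipation t = n * n" using dissipation_nonneg by (auto simp: n_def)
    have dpos: "deriv \<phi> (e t) > 0" using deriv_pos e(3)[OF t(1)] .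
    have "sqrt c \<le> sqrt ((deriv \<phi> (e t))\<^sup>2 * dissipation t)" using KLt[OF t] by simp
    also have "\<dots> = deriv \<phi> (e t) * n" using dpos by (simp add: real_sqrt_mult n_def)
    finally have "1 \<le> (deriv \<phi> (e t) * n) / sqrt c" using c by simp
    from mult_right_mono[OF this n(1)] have "n \<le> K * (deriv \<phi> (e t) * (\<alpha> * dissipation t))"
      using \<alpha> c by (simp add: K_def n(2) field_simps)
    also have "\<dots> \<le> K * (deriv \<phi> (e t) * - E' t)"
      using decay[of t] t T K dpos by (intro mult_left_mono) auto
    finally show ?thesis by (simp add: P'_def n_def)
  qed
  have len: "norm (u b - u a) \<le> K * \<phi> (e a) - K * \<phi> (e b)"
    if ab: "T \<le> a" "a \<le> b" "\<And>x. a < x \<Longrightarrow> x < b \<Longrightarrow> u x \<in> cball w \<rho>" for a b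
  proof (cases "a = b")
    case False
    have "norm (u b - u a) \<le> (- (K * \<phi> (e b))) - (- (K * \<phi> (e a)))"
    proof (rule differentiable_bound_general[of a b u "\<lambda>t. - (K * \<phi> (e t))" u' "\<lambda>t. - P' t"])
      show "a < b" using False ab by simp
      show "continuous_on {a..b} u"
        by (intro continuous_at_imp_continuous_on ballI isCont_u) (use ab T in auto)
      have "isCont (\<lambda>t. K * \<phi> (e t)) x" if "x \<in> {a..b}" for x
        using DERIV_isCont[OF P[of x]] that ab by auto
      then show "continuous_on {a..b} (\<lambda>t. - (K * \<phi> (e t)))"
        by (intro continuous_on_minus continuous_at_imp_continuous_on) auto
    next
      fix x assume x: "a < x" "x < b"
      then have xT: "x \<ge> T" using ab by simp
      show "(u has_vector_derivative u' x) (at x)" using u_deriv xT T by simp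
      show "((\<lambda>t. - (K * \<phi> (e t))) has_vector_derivative - P' x) (at x)"
        using DERIV_minus[OF P[OF xT]] by (simp add: has_real_derivative_iff_has_vector_derivative)
      show "norm (u' x) \<le> - P' x"
        using u'_le_dissipation[of x] speed[OF xT ab(3)[OF x]] by linarith
    qed
    then show ?thesis by simp
  qed simp
  have trap: "u t \<in> cball w \<rho>" if t: "t \<ge> T" for t
  proof (rule ccontr)
    assume out: "u t \<notin> cball w \<rho>"
    \<comment> \<open>The least element \<open>b\<close> of \<open>X\<close> is the first time at
      distance \<open>\<rho>\<close>. The length bound applies up to \<open>b\<close> and gives a
      distance below \<open>\<rho> / 2\<close> there.\<close>
    define X where "X = {T..t} \<inter> (\<lambda>x. dist w (u x)) -` {\<rho>..}"
    have "continuous_on {T..t} u"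
      by (intro continuous_at_imp_continuous_on ballI isCont_u) (use T in auto)
    then have "closed X"
      unfolding X_def by (intro continuous_closed_preimage continuous_intros) auto
    then have "compact ({T..t} \<inter> X)" by (intro compact_Int_closed compact_Icc)
    moreover have "{T..t} \<inter> X = X" by (auto simp: X_def)
    ultimately have "compact X" by (simp only:)
    moreover have "t \<in> X" using out t by (simp add: X_def)
    then have "X \<noteq> {}" by blast
    ultimately have "\<exists>b\<in>X. \<forall>x\<in>X. b \<le> x" by (rule compact_attains_inf)
    then obtain b where b: "b \<in> X" "\<And>x. x \<in> X \<Longrightarrow> b \<le> x" by blast
    have bT: "T \<le> b" and b\<rho>: "\<rho> \<le> dist w (u b)" and bt: "b \<le> t" using b(1) by (auto simp: X_def)
    have "u x \<in> cball w \<rho>" if x: "T < x" "x < b" for x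
      using b(2)[of x] x bt by (fastforce simp: X_def)
    from len[OF order_refl bT this] have "dist (u b) (u T) < \<rho> / 4"
      using \<phi>e[OF bT] \<phi>e(2)[OF order_refl] by (simp add: dist_norm)
    then have "dist w (u b) < \<rho>"
      using T(2) dist_triangle[of w "u b" "u T"] \<rho> by (simp add: dist_commute)
    with b\<rho> show False by simp
  qed
  \<comment> \<open>Convergence to \<open>w\<close> is known only along \<open>s\<close>, but the
    length from \<open>t\<close> to \<open>s k\<close> is bounded uniformly in
    \<open>k\<close>.\<close>
  have rate: "norm (u t - w) \<le> K * \<phi> (e t)" if t: "t \<ge> T" for t
  proof (rule tendsto_upperbound)
    show "(\<lambda>k. norm (u t - u (s k))) \<longlonglongrightarrow> norm (u t - w)" by (intro tendsto_intros s(2))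
    have "\<forall>\<^sub>F k in sequentially. s k \<ge> t" using s(1) by (simp add: filterlim_at_top)
    then show "\<forall>\<^sub>F k in sequentially. norm (u t - u (s k)) \<le> K * \<phi> (e t)"
    proof eventually_elim
      case (elim k)
      have "norm (u (s k) - u t) \<le> K * \<phi> (e t) - K * \<phi> (e (s k))"
        using t elim by (intro len trap) auto
      then show ?case using \<phi>e(1)[of "s k"] t elim by (simp add: norm_minus_commute)
    qed
  qed simp
  show thesis
    by (rule that[OF T(1) c K]) (use e(3) KLt speed trap rate in \<open>auto simp: e_def P'_def\<close>)
qed

end

section \<open>The worst-case gradient system\<close>

text \<open>This turns an estimate for late times into one from time 0: on the remaining compact
  interval the quotient is bounded.\<close>

lemma le_multiple_on_halfline:
  fixes f \<nu> :: "real \<Rightarrow> real"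
  assumes "continuous_on {0..} f" "continuous_on {0..} \<nu>"
    and pos: "\<And>t. t \<ge> 0 \<Longrightarrow> \<nu> t > 0"
    and le: "\<And>t. t \<ge> T \<Longrightarrow> f t \<le> C * \<nu> t"
  shows "\<exists>c. \<forall>t\<ge>0. f t \<le> c * \<nu> t"
proof -
  have "continuous_on {0..T} (\<lambda>t. f t / \<nu> t)"
    using continuous_on_subset[OF assms(1)] continuous_on_subset[OF assms(2)] pos
    by (intro continuous_on_divide) (auto simp: less_imp_neq[symmetric] dest: pos)
  then have "bounded ((\<lambda>t. f t / \<nu> t) ` {0..T})"
    by (intro compact_imp_bounded compact_continuous_image) auto
  then obtain B where B: "\<forall>t\<in>{0..T}. \<bar>f t / \<nu> t\<bar> \<le> B"
    unfolding bounded_iff by auto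
  have "f t \<le> max B C * \<nu> t" if t: "t \<ge> 0" for t
  proof (cases "t \<le> T")
    case True
    then have "\<bar>f t / \<nu> t\<bar> \<le> B" using bspec[OF B, of t] t by simp
    then have "f t / \<nu> t \<le> B" by linarith
    then have "f t \<le> B * \<nu> t" using pos[OF t] by (simp add: pos_divide_le_eq)
    also have "\<dots> \<le> max B C * \<nu> t" using pos[OF t] by (intro mult_right_mono) auto
    finally show ?thesis .
  next
    case False
    then have "f t \<le> C * \<nu> t" using le by simp
    also have "\<dots> \<le> max B C * \<nu> t" using pos[OF t] by (intro mult_right_mono) auto
    finally show ?thesis .
  qed
  then show ?thesis by blast
qed

lemma has_real_derivative_inv_into:
  fixes f :: "real \<Rightarrow> real"
  assumes "x \<in> interior A" and contf: "continuous_on A f" and inj: "inj_on f A"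
    and f': "(f has_real_derivative d) (at x)" and "d \<noteq> 0"
  shows "(inv_into A f has_real_derivative inverse d) (at (f x))"
  unfolding has_field_derivative_def
proof (rule has_derivative_inverse_strong[where S="interior A" and f=f and f'="(*) d"])
  show "continuous_on (interior A) f" using contf interior_subset by (rule continuous_on_subset)
  show "inv_into A f (f y) = y" if "y \<in> interior A" for y
    using inj that interior_subset by (intro inv_into_f_f) auto
  show "(f has_derivative (*) d) (at x)" using f' by (simp add: has_field_derivative_def)
  show "(*) d \<circ> (*) (inverse d) = id" using \<open>d \<noteq> 0\<close> by (auto simp: fun_eq_iff)
qed (use assms(1) in auto)

text \<open>For a worst-case solution \<open>\<nu>\<close>, the variable \<open>\<sigma> = inv_into {0..<r} \<phi> \<nu>\<close> satisfies \<open>\<sigma>' = - 1 / (deriv \<phi> \<sigma>)\<^sup>2\<close>,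
  so an antiderivative of \<open>- (deriv \<phi>)\<^sup>2\<close> acts as a clock: it increases at unit speed along \<open>\<sigma>\<close>.\<close>

locale desing_clock = desing_profile +
  fixes F :: "real \<Rightarrow> real"
  assumes F_deriv: "s \<in> {0<..<r} \<Longrightarrow> (F has_real_derivative - (deriv \<phi> s)\<^sup>2) (at s)"
begin

lemma F_less:
  assumes "a \<in> {0<..<r}" "b \<in> {0<..<r}" "a < b"
  shows "F b < F a"
  using assms(3)
proof (rule DERIV_neg_imp_decreasing)
  fix x assume "a \<le> x" "x \<le> b"
  then have "x \<in> {0<..<r}" using assms by auto
  then show "\<exists>y. (F has_real_derivative y) (at x) \<and> y < 0"
    using F_deriv deriv_pos by (metis less_irrefl neg_less_0_iff_less zero_less_power)
qed

lemma F_le_iff: "a \<in> {0<..<r} \<Longrightarrow> b \<in> {0<..<r} \<Longrightarrow> F a \<le> F b \<longleftrightarrow> b \<le> a"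
  using F_less[of a b] F_less[of b a] by (cases a b rule: linorder_cases) auto

lemma F_inj: "inj_on F {0<..<r}"
  by (rule inj_onI) (metis F_le_iff order_antisym order_refl)

text \<open>By growth the derivative of \<open>F\<close> is at most
  \<open>- \<beta>\<^sup>2 / s\<close>, so near 0 \<open>F\<close> dominates
  \<open>- \<beta>\<^sup>2 * ln s\<close> up to a constant. Reaching 0 would thus take infinite
  time.\<close>

lemma F_blowup:
  obtains \<delta> where "0 < \<delta>" "\<delta> < r" "\<And>s. 0 < s \<Longrightarrow> s < \<delta> \<Longrightarrow> B < F s"
proof -
  obtain \<beta> \<eta>0 where \<beta>: "\<beta> > 0" "\<eta>0 > 0" "\<eta>0 \<le> r"
    "\<And>s. s \<in> {0<..<\<eta>0} \<Longrightarrow> \<beta> / sqrt s \<le> deriv \<phi> s"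
    using growth unfolding desing_growth_def by metis
  define \<eta> where "\<eta> = \<eta>0 / 2"
  have \<eta>: "0 < \<eta>" "\<eta> < \<eta>0" "\<eta> < r" using \<beta> by (auto simp: \<eta>_def)
  have F_ln: "F \<eta> + \<beta>\<^sup>2 * ln \<eta> \<le> F s + \<beta>\<^sup>2 * ln s" if s: "0 < s" "s \<le> \<eta>" for s
  proof (rule DERIV_nonpos_imp_nonincreasing[OF s(2), of "\<lambda>s. F s + \<beta>\<^sup>2 * ln s"])
    fix x assume x: "s \<le> x" "x \<le> \<eta>"
    then have x0: "0 < x" "x \<in> {0<..<r}" "x \<in> {0<..<\<eta>0}" using s \<eta> by auto
    have "((\<lambda>s. F s + \<beta>\<^sup>2 * ln s) has_real_derivative - (deriv \<phi> x)\<^sup>2 + \<beta>\<^sup>2 * (1 / x)) (at x)"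
      using x0 by (intro DERIV_add F_deriv DERIV_cmult) (auto intro!: derivative_eq_intros)
    moreover have "(\<beta> / sqrt x)\<^sup>2 \<le> (deriv \<phi> x)\<^sup>2"
      using \<beta>(1) \<beta>(4)[OF x0(3)] x0(1) by (intro power_mono) auto
    then have "- (deriv \<phi> x)\<^sup>2 + \<beta>\<^sup>2 * (1 / x) \<le> 0" using x0 by (simp add: power_divide)
    ultimately show "\<exists>y. ((\<lambda>s. F s + \<beta>\<^sup>2 * ln s) has_real_derivative y) (at x) \<and> y \<le> 0" by blast
  qed
  \<comment> \<open>At \<open>s = exp l\<close> the logarithmic lower bound for \<open>F s\<close>
    equals \<open>B\<close>.\<close>
  define l where "l = ln \<eta> - (B - F \<eta>) / \<beta>\<^sup>2"
  have "B < F s" if s: "0 < s" "s < min \<eta> (exp l)" for s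
  proof -
    have "ln s < l" using s by (metis exp_gt_zero less_trans ln_exp ln_less_cancel_iff min_less_iff_conj)
    then have "\<beta>\<^sup>2 * ln s < \<beta>\<^sup>2 * l" using \<beta> by simp
    also have "\<dots> = \<beta>\<^sup>2 * ln \<eta> - (B - F \<eta>)" using \<beta>(1) by (simp add: l_def right_diff_distrib[of _ "ln \<eta>"])
    finally show ?thesis using F_ln[of s] s by simp
  qed
  then show thesis using that[of "min \<eta> (exp l)"] \<eta> by simp
qed

lemma inv_deriv:
  assumes s: "s \<in> {0<..<r}"
  shows "(inv_into {0..<r} \<phi> has_real_derivative inverse (deriv \<phi> s)) (at (\<phi> s))"
  using s cont inj has_deriv[OF s] deriv_pos[OF s]
  by (intro has_real_derivative_inv_into) auto

lemma inv_vector_derivative: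
  assumes s: "s \<in> {0<..<r}"
  shows "vector_derivative (inv_into {0..<r} \<phi>) (at (\<phi> s) within \<phi> ` {0..<r}) = inverse (deriv \<phi> s)"
proof (rule vector_derivative_within)
  show "(inv_into {0..<r} \<phi> has_vector_derivative inverse (deriv \<phi> s)) (at (\<phi> s) within \<phi> ` {0..<r})"
    using inv_deriv[OF s] has_real_derivative_iff_has_vector_derivative has_vector_derivative_at_within by blast
  \<comment> \<open>A derivative within the image is unique only at a limit point; a connected set
    with more than one point has no isolated point.\<close>
  have "connected (\<phi> ` {0..<r})" by (intro connected_continuous_image cont) simp
  moreover have "\<phi> ` {0..<r} \<noteq> {x}" for x
  proof -
    have "\<phi> 0 \<noteq> \<phi> s" using inj_onD[OF inj, of 0 s] s by auto
    moreover have "\<phi> 0 \<in> \<phi> ` {0..<r}" "\<phi> s \<in> \<phi> ` {0..<r}" using s by auto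
    ultimately show ?thesis by (metis singletonD)
  qed
  ultimately have "\<phi> s islimpt \<phi> ` {0..<r}" using s by (intro connected_imp_perfect) auto
  then show "at (\<phi> s) within \<phi> ` {0..<r} \<noteq> bot" by (simp add: trivial_limit_within)
qed

lemma inv_in:
  assumes "y \<in> \<phi> ` {0..<r}" "y > 0"
  shows "inv_into {0..<r} \<phi> y \<in> {0<..<r}" and "\<phi> (inv_into {0..<r} \<phi> y) = y"
proof -
  show *: "\<phi> (inv_into {0..<r} \<phi> y) = y" using assms(1) by (rule f_inv_into_f)
  have "inv_into {0..<r} \<phi> y \<noteq> 0" using * zero assms(2) by force
  moreover have "inv_into {0..<r} \<phi> y \<in> {0..<r}" using assms(1) by (rule inv_into_into)
  ultimately show "inv_into {0..<r} \<phi> y \<in> {0<..<r}" by auto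
qed

lemma worst_case_continuous:
  assumes "worst_case_solution r \<phi> \<nu>"
  shows "continuous_on {0..} \<nu>"
  using assms unfolding worst_case_solution_def
  by (meson DERIV_continuous atLeast_iff continuous_on_eq_continuous_within)

text \<open>\<open>F\<close> is controlled only on the open interval, so the clock can be read only
  while the solution is positive. The bound \<open>b\<close> allows its use up to a supposed first
  zero.\<close>

lemma worst_case_clock:
  assumes sol: "worst_case_solution r \<phi> \<nu>"
    and b: "\<And>t. 0 \<le> t \<Longrightarrow> t < b \<Longrightarrow> \<nu> t > 0"
  shows "0 \<le> t \<Longrightarrow> t < b \<Longrightarrow> F (inv_into {0..<r} \<phi> (\<nu> t)) = F (inv_into {0..<r} \<phi> (\<nu> 0)) + t"
proof -
  assume t: "0 \<le> t" "t < b"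
  define f where "f t = F (inv_into {0..<r} \<phi> (\<nu> t)) - t" for t
  have "(f has_real_derivative 0) (at t within {0..<b})" if t: "t \<in> {0..<b}" for t
  proof -
    define s where "s = inv_into {0..<r} \<phi> (\<nu> t)"
    have s: "s \<in> {0<..<r}" "\<phi> s = \<nu> t"
      unfolding s_def using inv_in sol b t by (auto simp: worst_case_solution_def)
    have "(\<nu> has_real_derivative - inverse (deriv \<phi> s)) (at t within {0..})"
      using sol t inv_vector_derivative[OF s(1)] by (auto simp: worst_case_solution_def s(2))
    then have \<nu>': "(\<nu> has_real_derivative - inverse (deriv \<phi> s)) (at t within {0..<b})"
      by (rule has_field_derivative_subset) auto
    have "((\<lambda>t. inv_into {0..<r} \<phi> (\<nu> t)) has_real_derivative
        inverse (deriv \<phi> s) * - inverse (deriv \<phi> s)) (at t within {0..<b})"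
      using DERIV_chain2[where f="inv_into {0..<r} \<phi>" and g=\<nu>, OF inv_deriv[OF s(1), unfolded s(2)] \<nu>'] .
    then have "((\<lambda>t. F (inv_into {0..<r} \<phi> (\<nu> t))) has_real_derivative
        - (deriv \<phi> s)\<^sup>2 * (inverse (deriv \<phi> s) * - inverse (deriv \<phi> s))) (at t within {0..<b})"
      using DERIV_chain2[where f=F and g="\<lambda>t. inv_into {0..<r} \<phi> (\<nu> t)", OF F_deriv[OF s(1), unfolded s_def]]
      by (simp only: s_def)
    moreover have "- (deriv \<phi> s)\<^sup>2 * (inverse (deriv \<phi> s) * - inverse (deriv \<phi> s)) = 1"
      using deriv_pos[OF s(1)] by (simp add: power2_eq_square field_simps)
    ultimately show ?thesis
      unfolding f_def by (auto intro!: derivative_eq_intros)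
  qed
  then have "\<exists>c. \<forall>t\<in>{0..<b}. f t = c"
    by (intro has_field_derivative_zero_constant convex_real_interval)
  then obtain c where "\<forall>t\<in>{0..<b}. f t = c" by blast
  then have "f t = f 0" using t by auto
  then show ?thesis by (simp add: f_def)
qed

text \<open>At a first zero \<open>b\<close> the clock would have advanced only by \<open>b\<close>,
  but \<open>F\<close> is unbounded near 0. So the solution stays above some
  \<open>\<phi> \<delta> > 0\<close> before \<open>b\<close>, and by continuity at
  \<open>b\<close>.\<close>

lemma worst_case_pos:
  assumes sol: "worst_case_solution r \<phi> \<nu>" and t: "t \<ge> 0"
  shows "\<nu> t > 0"
proof (rule ccontr)
  assume not: "\<not> \<nu> t > 0"
  define X where "X = {0..t} \<inter> \<nu> -` {..0}"
  have contt: "continuous_on {0..t} \<nu>"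
    using worst_case_continuous[OF sol] by (rule continuous_on_subset) auto
  have "closed X" unfolding X_def by (intro continuous_closed_preimage contt) auto
  then have "compact ({0..t} \<inter> X)" by (intro compact_Int_closed compact_Icc)
  moreover have "{0..t} \<inter> X = X" by (auto simp: X_def)
  ultimately have "compact X" by (simp only:)
  moreover have "t \<in> X" using not t by (simp add: X_def)
  then have "X \<noteq> {}" by blast
  ultimately have "\<exists>b\<in>X. \<forall>x\<in>X. b \<le> x" by (rule compact_attains_inf)
  then obtain b where b: "b \<in> X" "\<And>x. x \<in> X \<Longrightarrow> b \<le> x" by blast
  have b0: "b > 0" using b(1) sol by (auto simp: X_def worst_case_solution_def order_le_less)
  have bt: "b \<le> t" "\<nu> b \<le> 0" using b(1) by (auto simp: X_def)
  have pos: "\<nu> x > 0" if "0 \<le> x" "x < b" for x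
  proof (rule ccontr)
    assume "\<not> \<nu> x > 0"
    then have "x \<in> X" using that bt by (simp add: X_def)
    then show False using b(2) that by fastforce
  qed
  obtain \<delta> where \<delta>: "0 < \<delta>" "\<delta> < r"
    "\<And>s. 0 < s \<Longrightarrow> s < \<delta> \<Longrightarrow> F (inv_into {0..<r} \<phi> (\<nu> 0)) + b < F s"
    using F_blowup[of "F (inv_into {0..<r} \<phi> (\<nu> 0)) + b"] by metis
  have lower: "\<phi> \<delta> \<le> \<nu> x" if x: "0 \<le> x" "x < b" for x
  proof -
    define s where "s = inv_into {0..<r} \<phi> (\<nu> x)"
    have s: "s \<in> {0<..<r}" "\<phi> s = \<nu> x"
      unfolding s_def using inv_in sol pos[OF x] x by (auto simp: worst_case_solution_def)
    have "F s \<le> F (inv_into {0..<r} \<phi> (\<nu> 0)) + b"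
      using worst_case_clock[OF sol pos x] x by (simp add: s_def)
    then have "\<delta> \<le> s" using \<delta>(3)[of s] s(1) by force
    then show ?thesis using le_iff[of \<delta> s] \<delta> s by auto
  qed
  have "\<phi> \<delta> \<le> \<nu> b"
  proof (rule continuous_ge_on_closure[of "{0..<b}" \<nu>])
    show "continuous_on (closure {0..<b}) \<nu>"
      using continuous_on_subset[OF contt] b0 bt by simp
  qed (use b0 lower in auto)
  moreover have "\<phi> 0 < \<phi> \<delta>" using \<delta> by (subst less_iff) auto
  ultimately show False using bt zero by simp
qed

text \<open>The system is solved by inverting the clock; the blow-up of \<open>F\<close> at 0 makes
  every later clock value attained, so the solution is global.\<close>

lemma worst_case_exists:
  assumes y: "y \<in> \<phi> ` {0<..<r}"
  shows "\<exists>\<nu>. worst_case_solution r \<phi> \<nu> \<and> \<nu> 0 = y"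
proof -
  obtain s0 where s0: "s0 \<in> {0<..<r}" "y = \<phi> s0" using y by blast
  define \<sigma> where "\<sigma> t = inv_into {0<..<r} F (F s0 + t)" for t
  have contF: "continuous_on {0<..<r} F"
    by (intro continuous_at_imp_continuous_on ballI DERIV_isCont[OF F_deriv])
  have range: "F s0 + t \<in> F ` {0<..<r}" if t: "t \<ge> 0" for t
  proof -
    obtain \<delta> where \<delta>: "0 < \<delta>" "\<delta> < r" "\<And>s. 0 < s \<Longrightarrow> s < \<delta> \<Longrightarrow> F s0 + t < F s"
      using F_blowup by metis
    define a where "a = min s0 (\<delta> / 2)"
    have a: "0 < a" "a \<le> s0" "a < \<delta>" using \<delta> s0 by (auto simp: a_def)
    have "F s0 + t \<le> F a" using \<delta>(3)[of a] a by simp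
    moreover have "continuous_on {a..s0} F"
      by (rule continuous_on_subset[OF contF]) (use a s0 in auto)
    ultimately obtain x where "a \<le> x" "x \<le> s0" "F x = F s0 + t"
      using IVT2'[of F s0 "F s0 + t" a] a t by auto
    then show ?thesis using a s0 by (intro image_eqI[of _ _ x]) auto
  qed
  have \<sigma>: "\<sigma> t \<in> {0<..<r}" "F (\<sigma> t) = F s0 + t" if "t \<ge> 0" for t
    unfolding \<sigma>_def using range[OF that] by (rule inv_into_into, rule f_inv_into_f)
  have \<sigma>0: "\<sigma> 0 = s0" unfolding \<sigma>_def using F_inj s0(1) by simp
  have \<sigma>': "(\<sigma> has_real_derivative - inverse ((deriv \<phi> (\<sigma> t))\<^sup>2)) (at t)" if t: "t \<ge> 0" for t
  proof -
    define d where "d = - (deriv \<phi> (\<sigma> t))\<^sup>2"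
    have "d \<noteq> 0" using deriv_pos[OF \<sigma>(1)[OF t]] by (simp add: d_def)
    then have "(inv_into {0<..<r} F has_real_derivative inverse d) (at (F (\<sigma> t)))"
      using \<sigma>(1)[OF t] F_deriv[OF \<sigma>(1)[OF t]] F_inj contF unfolding d_def
      by (intro has_real_derivative_inv_into) auto
    then have "(inv_into {0<..<r} F has_real_derivative inverse d) (at (F s0 + t))"
      by (simp only: \<sigma>(2)[OF t])
    moreover have "((\<lambda>t. F s0 + t) has_real_derivative 1) (at t)"
      by (auto intro!: derivative_eq_intros)
    ultimately have "((\<lambda>t. inv_into {0<..<r} F (F s0 + t)) has_real_derivative inverse d * 1) (at t)"
      by (rule DERIV_chain2)
    then show ?thesis by (simp add: d_def \<sigma>_def[abs_def])
  qed
  define \<nu> where "\<nu> t = \<phi> (\<sigma> t)" for t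
  have "worst_case_solution r \<phi> \<nu>"
    unfolding worst_case_solution_def
  proof (intro conjI allI impI)
    have "\<phi> 0 < \<phi> s0" using s0 by (subst less_iff) auto
    then show "\<nu> 0 > 0" by (simp add: \<nu>_def \<sigma>0 zero)
  next
    fix t :: real assume t: "0 \<le> t"
    then show "\<nu> t \<in> \<phi> ` {0..<r}" using \<sigma>(1) by (fastforce simp: \<nu>_def)
    define d where "d = deriv \<phi> (\<sigma> t)"
    have "d > 0" using deriv_pos[OF \<sigma>(1)[OF t]] by (simp add: d_def)
    have "(\<nu> has_real_derivative d * - inverse (d\<^sup>2)) (at t)"
      unfolding \<nu>_def d_def
      by (rule DERIV_chain2[where f=\<phi>, OF has_deriv[OF \<sigma>(1)[OF t]] \<sigma>'[OF t]])
    moreover have "d * - inverse (d\<^sup>2) = - inverse d"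
      using \<open>d > 0\<close> by (simp add: power2_eq_square)
    ultimately have "(\<nu> has_real_derivative - inverse d) (at t within {0..})"
      by (simp add: has_field_derivative_at_within)
    then show "(\<nu> has_real_derivative
           - vector_derivative (inv_into {0..<r} \<phi>) (at (\<nu> t) within \<phi> ` {0..<r})) (at t within {0..})"
      using inv_vector_derivative[OF \<sigma>(1)[OF t]] by (simp add: \<nu>_def d_def)
  qed
  then show ?thesis using \<sigma>0 s0 by (auto simp: \<nu>_def)
qed

text \<open>The clock advances at rate at least 2 along \<open>e\<close> and at rate 1 along the
  worst-case solution, so the former overtakes from any starting position. \<open>F\<close> is
  decreasing, so a larger clock value means a lower level.\<close>

lemma eventually_below_worst_case:
  assumes sol: "worst_case_solution r \<phi> \<nu>" and T: "T > 0"
    and e: "\<And>t. t \<ge> T \<Longrightarrow> e t \<in> {0<..<r}"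
    and e': "\<And>t. t \<ge> T \<Longrightarrow> (e has_real_derivative e' t) (at t)"
    and fast: "\<And>t. t \<ge> T \<Longrightarrow> 2 \<le> (deriv \<phi> (e t))\<^sup>2 * - e' t"
  obtains T' where "\<And>t. t \<ge> T' \<Longrightarrow> \<phi> (e t) \<le> \<nu> t"
proof -
  have F_e: "F (e T) + 2 * (t - T) \<le> F (e t)" if t: "T \<le> t" for t
  proof -
    have "F (e T) - 2 * T \<le> F (e t) - 2 * t"
    proof (rule DERIV_nonneg_imp_nondecreasing[OF t, of "\<lambda>t. F (e t) - 2 * t"])
      fix x assume x: "T \<le> x" "x \<le> t"
      have "((\<lambda>t. F (e t)) has_real_derivative - (deriv \<phi> (e x))\<^sup>2 * e' x) (at x)"
        using DERIV_chain2[where f=F, OF F_deriv[OF e[OF x(1)]] e'[OF x(1)]] .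
      then have "((\<lambda>t. F (e t) - 2 * t) has_real_derivative - (deriv \<phi> (e x))\<^sup>2 * e' x - 2) (at x)"
        by (auto intro!: derivative_eq_intros)
      then show "\<exists>y. ((\<lambda>t. F (e t) - 2 * t) has_real_derivative y) (at x) \<and> 0 \<le> y"
        using fast[OF x(1)] by force
    qed
    then show ?thesis by (simp add: algebra_simps)
  qed
  define s where "s t = inv_into {0..<r} \<phi> (\<nu> t)" for t
  \<comment> \<open>The time from which \<open>F (e T) + 2 * (t - T)\<close> is at least
    \<open>F (s 0) + t\<close>.\<close>
  define T' where "T' = max T (F (s 0) - F (e T) + 2 * T)"
  have "\<phi> (e t) \<le> \<nu> t" if t: "t \<ge> T'" for t
  proof -
    have tT: "t \<ge> T" "t \<ge> 0" "t \<ge> F (s 0) - F (e T) + 2 * T" using t T by (auto simp: T'_def)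
    have st: "s t \<in> {0<..<r}" "\<phi> (s t) = \<nu> t"
      unfolding s_def using inv_in worst_case_pos[OF sol tT(2)] sol tT(2)
      by (auto simp: worst_case_solution_def)
    have "F (s t) = F (s 0) + t"
      unfolding s_def using worst_case_clock[OF sol _ tT(2), of "t + 1"] worst_case_pos[OF sol] by simp
    also have "\<dots> \<le> F (e t)" using F_e[OF tT(1)] tT(3) by (simp add: algebra_simps)
    finally have "e t \<le> s t" using F_le_iff st e[OF tT(1)] by blast
    then show ?thesis using le_iff[of "e t" "s t"] st e[OF tT(1)] by auto
  qed
  then show thesis using that by blast
qed

end

lemma (in desing_profile) desing_clock_exists: "\<exists>F. desing_clock r \<phi> F"
proof -
  have "\<exists>F. \<forall>x. ereal 0 < ereal x \<longrightarrow> ereal x < ereal r \<longrightarrow> (F has_vector_derivative - (deriv \<phi> x)\<^sup>2) (at x)"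
    using cont_deriv r_pos
    by (intro einterval_antiderivative continuous_intros) (auto simp: continuous_on_eq_continuous_at)
  then obtain F where "\<And>x. x \<in> {0<..<r} \<Longrightarrow> (F has_real_derivative - (deriv \<phi> x)\<^sup>2) (at x)"
    by (auto simp: has_real_derivative_iff_has_vector_derivative)
  then have "desing_clock r \<phi> F" by unfold_locales
  then show ?thesis by blast
qed

section \<open>Convergence with rate\<close>

text \<open>\<open>P\<close> is the nonnegative function from whose decrease integrability will
  follow: a multiple of \<open>\<Phi> w\<close> at the energy excess, or 0 if the energy reaches its
  limit in finite time.\<close>

lemma (in bounded_damped_trajectory) convergence_with_rate:
  assumes cont_u: "continuous_on {0..} u"
    and desing: "\<And>x. desingularizing G x (r x) (\<Phi> x)" and growth: "\<And>x. desing_growth (r x) (\<Phi> x)"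
  obtains w T P P' where "grad G w = 0" "(u \<longlongrightarrow> w) at_top" "worst_case_rate G u w (r w) (\<Phi> w)" "T > 0"
    and "\<And>t. t \<ge> T \<Longrightarrow> (P has_real_derivative P' t) (at t)"
    and "\<And>t. t \<ge> T \<Longrightarrow> sqrt (dissipation t) \<le> - P' t"
    and "\<And>t. t \<ge> T \<Longrightarrow> 0 \<le> P t"
proof -
  obtain \<alpha> E E' B where \<alpha>: "\<alpha> > 0"
    and E': "\<And>t. t > 0 \<Longrightarrow> (E has_real_derivative E' t) (at t)"
    and decay: "\<And>t. t > 0 \<Longrightarrow> E' t \<le> - \<alpha> * dissipation t"
    and near: "\<And>t. \<bar>E t - G (u t)\<bar> \<le> dissipation t"
    and B: "\<And>t. t > 0 \<Longrightarrow> B \<le> E t"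
    by (rule strict_Lyapunov) (rule that)
  obtain w s where crit: "grad G w = 0"
    and s: "filterlim s at_top sequentially" "(\<lambda>k. u (s k)) \<longlonglongrightarrow> w"
    and anti: "antimono_on {0<..} E" and E_lim: "(E \<longlongrightarrow> G w) at_top"
    and lower: "\<And>t. t > 0 \<Longrightarrow> G w \<le> E t"
    by (rule Lyapunov_limit[OF \<alpha> E' decay near B]) (assumption | rule that)+
  have diff: "G differentiable (at x)" for x using C2 by (simp add: C2_function_def)
  have cont_dist: "continuous_on {0..} (\<lambda>t. norm (u t - w))" by (intro continuous_intros cont_u)
  have rateI: "worst_case_rate G u w (r w) (\<Phi> w)"
    if k: "k \<ge> 1" and est: "\<And>F \<nu>. desing_clock (r w) (\<lambda>x. k * \<Phi> w x) F \<Longrightarrow>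
      worst_case_solution (r w) (\<lambda>x. k * \<Phi> w x) \<nu> \<Longrightarrow>
      (\<And>t. t \<ge> 0 \<Longrightarrow> \<nu> t > 0) \<Longrightarrow> \<exists>T C. \<forall>t\<ge>T. norm (u t - w) \<le> C * \<nu> t" for k
  proof -
    note scaled = desingularizing_scale[OF desing[of w] growth[of w] diff k]
    interpret desing_profile "r w" "\<lambda>x. k * \<Phi> w x"
      using scaled(1,2) by (rule desing_profileI)
    obtain F where "desing_clock (r w) (\<lambda>x. k * \<Phi> w x) F" using desing_clock_exists by blast
    then interpret desing_clock "r w" "\<lambda>x. k * \<Phi> w x" F .
    have "\<exists>c. \<forall>t\<ge>0. norm (u t - w) \<le> c * \<nu> t"
      if sol: "worst_case_solution (r w) (\<lambda>x. k * \<Phi> w x) \<nu>" for \<nu>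
    proof -
      obtain T C where "\<forall>t\<ge>T. norm (u t - w) \<le> C * \<nu> t"
        using est[OF desing_clock_axioms sol worst_case_pos[OF sol]] by blast
      then show ?thesis
        using le_multiple_on_halfline[OF cont_dist worst_case_continuous[OF sol] worst_case_pos[OF sol]]
        by blast
    qed
    then show ?thesis
      unfolding worst_case_rate_def using k scaled(1) worst_case_exists by blast
  qed
  show thesis
  proof (cases "\<exists>T>0. E T = G w")
    case True
    then obtain T where T: "T > 0" "E T = G w" by blast
    note stationary = stationary_after_equality[OF \<alpha> E' decay s anti lower T]
    have u_eq: "u t = w" and dis: "dissipation t = 0" if "t \<ge> T + 1" for t
      using stationary[of t] that by auto
    have "(u \<longlongrightarrow> w) at_top"
      by (rule tendsto_eventually) (use eventually_ge_at_top[of "T + 1"] in \<open>eventually_elim, simp add: u_eq\<close>)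
    moreover have "worst_case_rate G u w (r w) (\<Phi> w)"
    proof (rule rateI[OF order_refl])
      show "\<exists>T C. \<forall>t\<ge>T. norm (u t - w) \<le> C * \<nu> t" for \<nu> :: "real \<Rightarrow> real"
        by (intro exI[of _ "T + 1"] exI[of _ 0]) (simp add: u_eq)
    qed
    ultimately show thesis
      using crit T dis by (intro that[of w "T + 1" "\<lambda>_. 0" "\<lambda>_. 0"]) auto
  next
    case False
    then have "G w < E t" if "t > 0" for t using lower[OF that] that by (metis order_le_less)
    then obtain T c K where T: "T > 0" and c: "c > 0" and K: "K > 0"
      and e: "\<And>t. t \<ge> T \<Longrightarrow> E t - G w \<in> {0<..<r w}"
      and KL: "\<And>t. t \<ge> T \<Longrightarrow> c \<le> (deriv (\<Phi> w) (E t - G w))\<^sup>2 * dissipation t"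
      and speed: "\<And>t. t \<ge> T \<Longrightarrow> sqrt (dissipation t) \<le> - (K * (deriv (\<Phi> w) (E t - G w) * E' t))"
      and rate: "\<And>t. t \<ge> T \<Longrightarrow> norm (u t - w) \<le> K * \<Phi> w (E t - G w)"
      using trapped_near_critical_point[OF \<alpha> E' decay near crit s anti E_lim _ desing growth] by metis
    interpret \<phi>: desing_profile "r w" "\<Phi> w" using desing growth by (rule desing_profileI)
    \<comment> \<open>Since \<open>k \<ge> 1\<close>, its square is at least \<open>k\<close> and
      hence at least \<open>2 / (\<alpha> * c)\<close>; this gives the rate 2 in the
      comparison.\<close>
    define k where "k = 1 + 2 / (\<alpha> * c)"
    have k: "k \<ge> 1" using \<alpha> c by (simp add: k_def)
    have "2 = (2 / (\<alpha> * c)) * (\<alpha> * c)" using \<alpha> c by simp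
    also have "\<dots> \<le> k\<^sup>2 * (\<alpha> * c)"
      using \<alpha> c k self_le_power[of k 2] by (intro mult_right_mono) (auto simp: k_def)
    finally have k2: "2 \<le> k\<^sup>2 * (\<alpha> * c)" .
    note deriv_k = desingularizing_scale(3)[OF desing[of w] growth[of w] diff k]
    have e': "((\<lambda>t. E t - G w) has_real_derivative E' t) (at t)" if "t \<ge> T" for t
      using E'[of t] that T by (auto intro!: derivative_eq_intros)
    have "worst_case_rate G u w (r w) (\<Phi> w)"
    proof (rule rateI[OF k])
      fix F \<nu>
      assume "desing_clock (r w) (\<lambda>x. k * \<Phi> w x) F"
        and sol: "worst_case_solution (r w) (\<lambda>x. k * \<Phi> w x) \<nu>"
      then interpret desing_clock "r w" "\<lambda>x. k * \<Phi> w x" F by simp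
      have fast: "2 \<le> (deriv (\<lambda>x. k * \<Phi> w x) (E t - G w))\<^sup>2 * - E' t" if t: "t \<ge> T" for t
      proof -
        define d where "d = deriv (\<Phi> w) (E t - G w)"
        have "2 \<le> k\<^sup>2 * (\<alpha> * c)" by (rule k2)
        also have "\<dots> \<le> k\<^sup>2 * (\<alpha> * (d\<^sup>2 * dissipation t))"
          using KL[OF t] \<alpha> by (intro mult_left_mono) (auto simp: d_def)
        also have "\<dots> = (k * d)\<^sup>2 * (\<alpha> * dissipation t)" by (simp add: power_mult_distrib)
        also have "\<dots> \<le> (k * d)\<^sup>2 * - E' t"
          using decay[of t] t T by (intro mult_left_mono) auto
        finally show ?thesis
          using deriv_k[OF e[OF t]] by (simp add: d_def)
      qed
      obtain T' where T': "\<And>t. t \<ge> T' \<Longrightarrow> k * \<Phi> w (E t - G w) \<le> \<nu> t"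
        using eventually_below_worst_case[OF sol T e e' fast] by metis
      have "norm (u t - w) \<le> K * \<nu> t" if t: "t \<ge> max T T'" for t
      proof -
        have "0 \<le> \<Phi> w (E t - G w)" using \<phi>.nonneg e[of t] t by auto
        then have "\<Phi> w (E t - G w) \<le> k * \<Phi> w (E t - G w)"
          using k by (simp add: mult_le_cancel_right1)
        also have "\<dots> \<le> \<nu> t" using T' t by simp
        finally show ?thesis using rate[of t] t K by (meson max.boundedE mult_left_mono order_less_imp_le order_trans)
      qed
      then show "\<exists>T C. \<forall>t\<ge>T. norm (u t - w) \<le> C * \<nu> t" by blast
    qed
    moreover have "(u \<longlongrightarrow> w) at_top"
    proof (rule tendstoI)
      fix \<epsilon> :: real assume \<epsilon>: "\<epsilon> > 0"
      obtain d where d: "0 < d" "\<And>x. 0 \<le> x \<Longrightarrow> x < d \<Longrightarrow> \<Phi> w x < \<epsilon> / K"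
        using \<phi>.small_values[of "\<epsilon> / K"] \<epsilon> K by (metis divide_pos_pos)
      have "\<forall>\<^sub>F t in at_top. E t < G w + d"
        using E_lim by (rule order_tendstoD) (use d in simp)
      then show "\<forall>\<^sub>F t in at_top. dist (u t) w < \<epsilon>"
        using eventually_ge_at_top[of T]
      proof eventually_elim
        case (elim t)
        then have "\<Phi> w (E t - G w) < \<epsilon> / K" using e[of t] by (intro d(2)) auto
        then have "K * \<Phi> w (E t - G w) < \<epsilon>" using K by (simp add: field_simps)
        then show ?case using rate[of t] elim by (simp add: dist_norm)
      qed
    qed
    moreover have "((\<lambda>t. K * \<Phi> w (E t - G w)) has_real_derivative
        K * (deriv (\<Phi> w) (E t - G w) * E' t)) (at t)" if "t \<ge> T" for t
      by (intro DERIV_cmult DERIV_chain2[where f="\<Phi> w", OF \<phi>.has_deriv[OF e[OF that]] e'[OF that]])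
    moreover have "0 \<le> K * \<Phi> w (E t - G w)" if "t \<ge> T" for t
      using rate[OF that] norm_ge_zero order_trans by blast
    ultimately show thesis
      using crit T speed
      by (intro that[of w T "\<lambda>t. K * \<Phi> w (E t - G w)" "\<lambda>t. K * (deriv (\<Phi> w) (E t - G w) * E' t)"])
  qed
qed

theorem theorem4p1:
  fixes G :: "real ^ 'n \<Rightarrow> real"
    and \<gamma> :: real
    and u0 v0 :: "real ^ 'n"
    and u u' u'' :: "real \<Rightarrow> real ^ 'n"
    and r :: "real ^ 'n \<Rightarrow> real"
    and \<Phi> :: "real ^ 'n \<Rightarrow> real \<Rightarrow> real"
  assumes "\<gamma> > 0"
    and "C2_function G"
    and "damped_solution \<gamma> G u0 v0 u u' u''"
    and "bounded (u ` {0<..})"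
    and "KL_function G"
    and "\<And>ubar. desingularizing G ubar (r ubar) (\<Phi> ubar)"
    and "\<And>ubar. desing_growth (r ubar) (\<Phi> ubar)"
  shows "u' absolutely_integrable_on {0<..} \<and> u'' absolutely_integrable_on {0<..} \<and>
         (\<exists>u_inf\<in>crit G. (u \<longlongrightarrow> u_inf) at_top) \<and>
         (\<forall>u_inf. (u \<longlongrightarrow> u_inf) at_top \<longrightarrow>
            worst_case_rate G u u_inf (r u_inf) (\<Phi> u_inf))"
proof -
  have du: "(u has_vector_derivative u' t) (at t within {0..})"
    and du': "(u' has_vector_derivative u'' t) (at t within {0..})"
    and ode: "u'' t + \<gamma> *\<^sub>R u' t + grad G (u t) = 0" if "t \<ge> 0" for t
    using assms(3) that unfolding damped_solution_def by blast+
  have cont_u'': "continuous_on {0..} u''"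
    using assms(3) unfolding damped_solution_def by blast
  have cont_u: "continuous_on {0..} u" and cont_u': "continuous_on {0..} u'"
    using has_vector_derivative_continuous[OF du] has_vector_derivative_continuous[OF du']
    by (simp_all add: continuous_on_eq_continuous_within)
  interpret bounded_damped_trajectory \<gamma> G u u' u''
  proof
    fix t :: real assume t: "t > 0"
    have at: "at t within {0..} = at t" using t by (intro at_within_interior) simp
    show "(u has_vector_derivative u' t) (at t)" using du[of t] t by (simp add: at)
    show "(u' has_vector_derivative u'' t) (at t)" using du'[of t] t by (simp add: at)
    have "u'' t + (\<gamma> *\<^sub>R u' t + grad G (u t)) = 0" using ode[of t] t by (simp add: add.assoc)
    then have "u'' t = - (\<gamma> *\<^sub>R u' t + grad G (u t))" by (simp only: add_eq_0_iff2)
    then show "u'' t = - \<gamma> *\<^sub>R u' t - grad G (u t)" by simp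
  qed (fact assms)+
  obtain w T P P' where w: "grad G w = 0" "(u \<longlongrightarrow> w) at_top" "worst_case_rate G u w (r w) (\<Phi> w)"
    and T: "T > 0" and P': "\<And>t. t \<ge> T \<Longrightarrow> (P has_real_derivative P' t) (at t)"
    and speed: "\<And>t. t \<ge> T \<Longrightarrow> sqrt (dissipation t) \<le> - P' t"
    and P: "\<And>t. t \<ge> T \<Longrightarrow> 0 \<le> P t"
    by (rule convergence_with_rate[OF cont_u assms(6,7)]) (assumption | rule that)+
  have "u' absolutely_integrable_on {0<..}"
  proof (rule absolutely_integrable_on_halfline_bounded_by_derivative[OF cont_u' _ P' _ P])
    show "norm (u' t) \<le> - P' t" if "t \<ge> T" for t
      using u'_le_dissipation[of t] speed[OF that] by linarith
  qed (use T in simp_all)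
  moreover have "u'' absolutely_integrable_on {0<..}"
  proof (rule absolutely_integrable_on_halfline_bounded_by_derivative[OF cont_u''])
    show "((\<lambda>t. (\<gamma> + 1) * P t) has_real_derivative (\<gamma> + 1) * P' t) (at t)" if "t \<ge> T" for t
      using DERIV_cmult[OF P'[OF that]] .
    show "norm (u'' t) \<le> - ((\<gamma> + 1) * P' t)" if "t \<ge> T" for t
      using u''_le_dissipation[of t] mult_left_mono[OF speed[OF that], of "\<gamma> + 1"] that T assms(1) by simp
    show "0 \<le> (\<gamma> + 1) * P t" if "t \<ge> T" for t using P[OF that] assms(1) by simp
  qed (use T in simp)
  moreover have "worst_case_rate G u x (r x) (\<Phi> x)" if "(u \<longlongrightarrow> x) at_top" for x
  proof -
    have "x = w" using tendsto_unique[OF _ that w(2)] by simp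
    then show ?thesis using w(3) by simp
  qed
  moreover have "w \<in> crit G" using w(1) by (simp add: crit_def)
  ultimately show ?thesis using w(2) by blast
qed

end
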